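(* Let $\alpha$ be a positive integer. For $m\in\mathbb Z$ let $\mathcal P_{2\alpha,m}$ be the set of partitions $\lambda=(\lambda_1,\dots,\lambda_l)$ such that $\lambda_i-\lambda_{i+1}\ge 2\alpha$ for $1\le i<l$ and $\lambda_l\ge(2m+1)\alpha$. Then the set of products $$X_{-\lambda}e^{mh}\qquad(\lambda\in\mathcal P_{2\alpha,m},\ m\in\mathbb Z)$$ forms an $F$-basis in the vertex algebra $V$. Moreover, for a partition $\lambda$ of length $l$ with $\lambda_l\ge(2m+1)\alpha$, one has $$X_{-\lambda}e^{mh}=\sum_{\mu\ge\lambda}a_{\lambda\mu}(\alpha^{-1})\,H_{\mu-(2m+1)\alpha\mathbf 1-2\alpha\delta}\,e^{(m+l(\lambda))h},$$ where $\mu$ runs through compositions, the coefficients satisfy $a_{\lambda\lambda}(\alpha^{-1})=1$, $\mathbf 1=(1,\dots,1)\in\mathbb N^l$ and $\delta=(l-1,l-2,\dots,1,0)$.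
   Context: A partition $\lambda=(\lambda_1\ge\lambda_2\ge\cdots)$ is a finite nonincreasing sequence of nonnegative integers, also written $(1^{m_1}2^{m_2}\cdots)$ with $m_i$ the multiplicity of $i$; its length $l(\lambda)$ is the number of nonzero parts, and $z_\lambda=\prod_{i\ge1}i^{m_i}m_i!$. For partitions or compositions (here: integer sequences with $l$ entries) $\lambda,\mu$ of the same total sum, $\mu\ge\lambda$ means $\mu_1+\cdots+\mu_i\ge\lambda_1+\cdots+\lambda_i$ for all $i$. $F=\mathbb Q(\alpha)$ denotes the field of rational functions in $\alpha$. Space: $V_0=\mathrm{Sym}(h_{-1},h_{-2},\dots)$ is the symmetric algebra over $\mathbb C$ generated by $h_{-1},h_{-2},\dots$; for $n>0$, $h_{-n}$ acts by multiplication and $h_n$ acts as $\alpha^{-1}n\,\partial/\partial h_{-n}$; $h_{-\lambda}=h_{-\lambda_1}h_{-\lambda_2}\cdots$ (product over nonzero parts). $V=V_0\otimes\mathbb C[\frac12\mathbb Z]$, where the group algebra $\mathbb C[\frac12\mathbb Z]$ has generators $e^{sh}$, $s\in\frac12\mathbb Z$, with $e^{rh}e^{sh}=e^{(r+s)h}$; the operators $h_{\pm n}$ act on the first factor, and $e^{sh}$ denotes $1\otimes e^{sh}$. Vertex operator: $$X(z)=\exp\Big(\sum_{n\ge1}\frac{z^n}{n}\alpha h_{-n}\Big)\exp(2\alpha\ln z\,\partial_h+h)\exp\Big(\sum_{n\ge1}\frac{z^{-n}}{-n}2\alpha h_n\Big)=\sum_{n\in\mathbb Z}X_nz^{-n},$$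 where the middle factor acts by $e^{sh}\mapsto z^{(s+\frac12)2\alpha}e^{(s+1)h}$. For $\lambda=(\lambda_1,\dots,\lambda_l)$, $X_{-\lambda}=X_{-\lambda_1}X_{-\lambda_2}\cdots X_{-\lambda_l}$. Generalized homogeneous functions: $H_n=H_n(\alpha^{-1})=\sum_{\lambda\vdash n}\alpha^{l(\lambda)}z_\lambda^{-1}h_{-\lambda}\in V_0$ for $n\ge0$, $H_n=0$ for $n<0$, and $H_{(k_1,\dots,k_l)}=H_{k_1}\cdots H_{k_l}$.
   Formalization: The entries of λ may be any integers, not only nonnegative ones; with m in Z the products form a basis of the part of V with integral charges, with m in ½Z of all of V; they are a C-basis, and an F-basis (F = Q) only of the rational form, since V is a complex space. *)

theory Defs
  imports Complex_Main "HOL-Library.Poly_Mapping" "HOL-Library.Multiset"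
begin

section \<open>The space\<close>

text \<open>
  \<open>V0\<close> is the polynomial ring (symmetric algebra) over the complex numbers in the variables
  \<open>h\<^sub>-\<^sub>1, h\<^sub>-\<^sub>2, \<dots>\<close>. Variable number \<open>i\<close> of the monomial type is \<open>h\<close> with index \<open>-(i + 1)\<close>, so that
  there is no variable with index \<open>0\<close>.

  \<open>V\<close> is \<open>V0\<close> tensored with the group algebra of the half-integers, that is, the group algebra of
  the half-integers with coefficients in \<open>V0\<close>. The half-integer \<open>s\<close> is encoded by the integer \<open>2s\<close>;
  an index \<open>k :: int\<close> of \<open>V\<close> always stands for the charge \<open>k/2\<close>, and an integral charge \<open>m\<close> appears
  as \<open>2 * m\<close>.
\<close>

type_synonym V0 = "(nat \<Rightarrow>\<^sub>0 nat) \<Rightarrow>\<^sub>0 complex"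
type_synonym V = "int \<Rightarrow>\<^sub>0 V0"

definition scale0 :: "complex \<Rightarrow> V0 \<Rightarrow> V0" where
  "scale0 c p = Poly_Mapping.single 0 c * p"

definition scaleV :: "complex \<Rightarrow> V \<Rightarrow> V" where
  "scaleV c v = Poly_Mapping.single 0 (Poly_Mapping.single 0 c) * v"

definition scaleF :: "rat \<Rightarrow> V \<Rightarrow> V" where
  "scaleF q v = scaleV (of_rat q) v"

text \<open>\<open>tensor p k\<close> is \<open>p \<otimes> e\<^sup>s\<^sup>h\<close> with \<open>s = k/2\<close>, and \<open>exph k\<close> is \<open>e\<^sup>s\<^sup>h = 1 \<otimes> e\<^sup>s\<^sup>h\<close>.\<close>

definition tensor :: "V0 \<Rightarrow> int \<Rightarrow> V" where
  "tensor p k = Poly_Mapping.single k p"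

definition exph :: "int \<Rightarrow> V" where
  "exph k = tensor 1 k"

definition hvar :: "nat \<Rightarrow> V0" where
  "hvar n = Poly_Mapping.single (Poly_Mapping.single (n - 1) 1) 1"

text \<open>\<open>dh n\<close> is the partial derivative with respect to \<open>hvar n\<close>.\<close>

definition dh :: "nat \<Rightarrow> V0 \<Rightarrow> V0" where
  "dh n p = (\<Sum>u\<in>Poly_Mapping.keys p.
     Poly_Mapping.single (u - Poly_Mapping.single (n - 1) 1)
       (of_nat (Poly_Mapping.lookup u (n - 1)) * Poly_Mapping.lookup p u))"

definition h_neg :: "nat \<Rightarrow> V0 \<Rightarrow> V0" where
  "h_neg n p = hvar n * p"

definition h_pos :: "nat \<Rightarrow> nat \<Rightarrow> V0 \<Rightarrow> V0" where
  "h_pos \<alpha> n p = scale0 (inverse (of_nat \<alpha>) * of_nat n) (dh n p)"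


section \<open>The vertex operator\<close>

text \<open>
  For a formal series of operators \<open>A(w) = \<Sum>\<^sub>n\<^sub>\<ge>\<^sub>1 A\<^sub>n w\<^sup>n\<close>, \<open>op_pow A k n\<close> is the coefficient of \<open>w\<^sup>n\<close>
  in \<open>A(w)\<^sup>k\<close>, and \<open>op_exp A n\<close> is the coefficient of \<open>w\<^sup>n\<close> in \<open>exp (A(w)) = \<Sum>\<^sub>k A(w)\<^sup>k / k!\<close>, to
  which only \<open>k \<le> n\<close> contributes because \<open>A(w)\<close> has no constant term.
\<close>

fun op_pow :: "(nat \<Rightarrow> V0 \<Rightarrow> V0) \<Rightarrow> nat \<Rightarrow> nat \<Rightarrow> V0 \<Rightarrow> V0" where
  "op_pow A 0 n p = (if n = 0 then p else 0)"
| "op_pow A (Suc k) n p = (\<Sum>i=1..n. A i (op_pow A k (n - i) p))"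

definition op_exp :: "(nat \<Rightarrow> V0 \<Rightarrow> V0) \<Rightarrow> nat \<Rightarrow> V0 \<Rightarrow> V0" where
  "op_exp A n p = (\<Sum>k\<le>n. scale0 (1 / fact k) (op_pow A k n p))"

text \<open>\<open>E_neg \<alpha> i\<close> is the coefficient of \<open>z\<^sup>i\<close> in the left exponential factor of \<open>X(z)\<close>, and
  \<open>E_pos \<alpha> j\<close> is the coefficient of \<open>z\<^sup>-\<^sup>j\<close> in the right one.\<close>

definition E_neg :: "nat \<Rightarrow> nat \<Rightarrow> V0 \<Rightarrow> V0" where
  "E_neg \<alpha> = op_exp (\<lambda>n p. scale0 (1 / of_nat n * of_nat \<alpha>) (h_neg n p))"

definition E_pos :: "nat \<Rightarrow> nat \<Rightarrow> V0 \<Rightarrow> V0" where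
  "E_pos \<alpha> = op_exp (\<lambda>n p. scale0 (1 / (- of_nat n) * (2 * of_nat \<alpha>)) (h_pos \<alpha> n p))"

text \<open>
  \<open>X_mode \<alpha> n\<close> is \<open>X\<^sub>n\<close>, the coefficient of \<open>z\<^sup>-\<^sup>n\<close> in \<open>X(z)\<close>. On the component of charge \<open>s = k/2\<close>
  the middle factor of \<open>X(z)\<close> contributes \<open>z\<close> to the power \<open>(s + 1/2) 2\<alpha> = (k + 1) \<alpha>\<close> and raises the
  charge by \<open>1\<close>, that is, \<open>k\<close> by \<open>2\<close>. The sum over \<open>i, j\<close> has finitely many nonzero terms since
  \<open>E_pos \<alpha> j\<close> lowers the degree by \<open>j\<close>.
\<close>

definition X_mode :: "nat \<Rightarrow> int \<Rightarrow> V \<Rightarrow> V" where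
  "X_mode \<alpha> n v = (\<Sum>k\<in>Poly_Mapping.keys v.
     tensor
       (Sum_any (\<lambda>(i, j). if int i + (k + 1) * int \<alpha> - int j = - n
                          then E_neg \<alpha> i (E_pos \<alpha> j (Poly_Mapping.lookup v k)) else 0))
       (k + 2))"

text \<open>\<open>X_neg \<alpha> [\<nu>\<^sub>1, \<dots>, \<nu>\<^sub>l]\<close> is the product of the modes with indices \<open>-\<nu>\<^sub>1, \<dots>, -\<nu>\<^sub>l\<close>, the last one
  acting first.\<close>

definition X_neg :: "nat \<Rightarrow> int list \<Rightarrow> V \<Rightarrow> V" where
  "X_neg \<alpha> \<nu> v = foldr (\<lambda>a. X_mode \<alpha> (- a)) \<nu> v"


section \<open>Generalized homogeneous functions\<close>

text \<open>Partitions of \<open>n\<close> are represented by the multiset of their (nonzero) parts.\<close>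

definition partitions :: "nat \<Rightarrow> nat multiset set" where
  "partitions n = {\<nu>. 0 \<notin># \<nu> \<and> sum_mset \<nu> = n}"

definition zee :: "nat multiset \<Rightarrow> nat" where
  "zee \<nu> = (\<Prod>i\<in>set_mset \<nu>. i ^ count \<nu> i * fact (count \<nu> i))"

definition H :: "nat \<Rightarrow> int \<Rightarrow> V0" where
  "H \<alpha> n = (if n < 0 then 0
     else (\<Sum>\<nu>\<in>partitions (nat n).
       scale0 (of_nat \<alpha> ^ size \<nu> * inverse (of_nat (zee \<nu>))) (\<Prod>i\<in>#\<nu>. hvar i)))"

definition H_list :: "nat \<Rightarrow> int list \<Rightarrow> V0" where
  "H_list \<alpha> ks = prod_list (map (H \<alpha>) ks)"

text \<open>\<open>shifted \<alpha> m \<mu>\<close> is \<open>\<mu> - (2m+1)\<alpha>(1, \<dots>, 1) - 2\<alpha>(l-1, \<dots>, 1, 0)\<close>, where \<open>l\<close> is the length of \<open>\<mu>\<close>.\<close>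

definition shifted :: "nat \<Rightarrow> int \<Rightarrow> int list \<Rightarrow> int list" where
  "shifted \<alpha> m \<mu> = map (\<lambda>i. \<mu> ! i - (2 * m + 1) * int \<alpha> - 2 * int \<alpha> * int (length \<mu> - 1 - i))
     [0..<length \<mu>]"


section \<open>Partitions and dominance\<close>

definition dominates :: "int list \<Rightarrow> int list \<Rightarrow> bool" where
  "dominates \<mu> \<nu> \<longleftrightarrow> length \<mu> = length \<nu> \<and> sum_list \<mu> = sum_list \<nu> \<and>
     (\<forall>i\<le>length \<nu>. sum_list (take i \<mu>) \<ge> sum_list (take i \<nu>))"

text \<open>
  \<open>diff_partitions \<alpha> k\<close> is the set of \<open>\<nu> = (\<nu>\<^sub>1, \<dots>, \<nu>\<^sub>l)\<close> with \<open>\<nu>\<^sub>i - \<nu>\<^sub>i\<^sub>+\<^sub>1 \<ge> 2\<alpha>\<close> and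
  \<open>\<nu>\<^sub>l \<ge> (2m+1)\<alpha>\<close>, where \<open>m = k/2\<close>. The entries are integers: for negative \<open>m\<close> the only lower bound
  is \<open>(2m+1)\<alpha>\<close>, and negative entries do occur. Without them the products fail to span: for
  \<open>\<alpha> = 1\<close> the degree 2 part of charge 0 is two-dimensional, but contains only one product
  with nonnegative entries.
\<close>

definition diff_partitions :: "nat \<Rightarrow> int \<Rightarrow> int list set" where
  "diff_partitions \<alpha> k = {\<nu>.
     (\<forall>i. Suc i < length \<nu> \<longrightarrow> \<nu> ! i - \<nu> ! Suc i \<ge> 2 * int \<alpha>) \<and>
     (\<nu> \<noteq> [] \<longrightarrow> last \<nu> \<ge> (k + 1) * int \<alpha>)}"

text \<open>The products with charges in \<open>K\<close>, as a set: the same vector arises from several pairs of a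
  charge and a sequence.\<close>

definition products :: "nat \<Rightarrow> int set \<Rightarrow> V set" where
  "products \<alpha> K = {X_neg \<alpha> \<nu> (exph k) | \<nu> k. k \<in> K \<and> \<nu> \<in> diff_partitions \<alpha> k}"


section \<open>Bases\<close>

global_interpretation VC: vector_space scaleV
  by unfold_locales
    (simp_all add: scaleV_def algebra_simps single_add mult_single flip: mult.assoc)

global_interpretation VF: vector_space scaleF
  by unfold_locales
    (simp_all add: scaleF_def of_rat_add of_rat_mult VC.scale_right_distrib VC.scale_left_distrib)

text \<open>\<open>V_charges K\<close> is the span of the \<open>V0 \<otimes> e\<^sup>s\<^sup>h\<close> with \<open>2s \<in> K\<close>.  \<open>V_rational K\<close> is its form over
  \<open>F\<close>, consisting of the combinations of the \<open>h\<^sub>-\<^sub>\<nu> \<otimes> e\<^sup>s\<^sup>h\<close> with coefficients in \<open>F\<close>; as \<open>\<alpha>\<close> is a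
  positive integer, the field \<open>F\<close> generated by \<open>\<alpha>\<close> consists of the rational numbers.\<close>

definition V_charges :: "int set \<Rightarrow> V set" where
  "V_charges K = {v. Poly_Mapping.keys v \<subseteq> K}"

definition V_rational :: "int set \<Rightarrow> V set" where
  "V_rational K = {v \<in> V_charges K. \<forall>k u. Poly_Mapping.lookup (Poly_Mapping.lookup v k) u \<in> \<rat>}"

definition is_C_basis :: "V set \<Rightarrow> V set \<Rightarrow> bool" where
  "is_C_basis B W \<longleftrightarrow> VC.independent B \<and> VC.span B = W"

definition is_F_basis :: "V set \<Rightarrow> V set \<Rightarrow> bool" where
  "is_F_basis B W \<longleftrightarrow> VF.independent B \<and> VF.span B = W"

end

theory Submission
  imports Defs
begin

text \<open>
  On a product of the \<open>H\<^sub>n\<close> the right exponential factor \<open>E_pos\<close> of \<open>X(z)\<close> acts as an algebra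
  homomorphism, namely the translation \<open>h\<^sub>-\<^sub>n \<mapsto> h\<^sub>-\<^sub>n - 2 z\<^sup>-\<^sup>n\<close>. It multiplies the generating
  function \<open>\<Sum>\<^sub>n H\<^sub>n w\<^sup>n = exp (\<Sum>\<^sub>n \<alpha> h\<^sub>-\<^sub>n w\<^sup>n / n)\<close> by \<open>(1 - w/z)\<^sup>2\<^sup>\<alpha>\<close>, while the left factor
  multiplies by this generating function at \<open>z\<close>. So each mode \<open>X\<^sub>-\<^sub>n\<close> adds a new factor to a product
  of \<open>H\<close>'s and moves units from the other indices to the new, leading one, which yields
  the dominance expansion by induction on the length.

  For the basis property, a sequence dominating a sorted one and different from it has a larger sum
  of squares. By induction on this sum, every product of \<open>H\<close>'s of degree \<open>n\<close> and a given charge is a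
  rational combination of the vectors \<open>X\<^sub>-\<^sub>\<nu> e\<^sup>m\<^sup>h\<close> of the same charge and degree, and hence so is every
  monomial in the \<open>h\<^sub>-\<^sub>i\<close>. As both families are indexed by the partitions of \<open>n\<close>, independence follows
  by counting dimensions.
\<close>

section \<open>Exponentials of commuting operators\<close>

global_interpretation V0C: vector_space scale0
  by unfold_locales
    (simp_all add: scale0_def algebra_simps single_add mult_single flip: mult.assoc)

lemma scale0_mult_left: "scale0 c p * q = scale0 c (p * q)"
  and scale0_mult_right: "p * scale0 c q = scale0 c (p * q)"
  by (simp_all add: scale0_def ac_simps)

lemma scale0_of_nat_cancel:
  assumes "n > 0" and "scale0 (of_nat n) p = scale0 (of_nat n) q"
  shows "p = q"
  using assms by simp

lemma lookup_scale0: "Poly_Mapping.lookup (scale0 c p) u = c * Poly_Mapping.lookup p u"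
  unfolding scale0_def mult_map_scale_conv_mult[symmetric]
  by (simp add: Poly_Mapping.map.rep_eq when_def)

lemma sum_nested_swap:
  fixes f :: "nat \<Rightarrow> nat \<Rightarrow> 'a :: comm_monoid_add"
  shows "(\<Sum>i=1..n. \<Sum>j=1..n-i. f i j) = (\<Sum>j=1..n. \<Sum>i=1..n-j. f i j)"
  unfolding sum.Sigma[OF finite_atLeastAtMost ballI[OF finite_atLeastAtMost]]
  by (rule sum.reindex_bij_witness[where i="\<lambda>(a, b). (b, a)" and j="\<lambda>(a, b). (b, a)"]) auto

text \<open>Commuting coefficients let powers of \<open>A\<close> be differentiated formally as in a
  commutative ring, so that the exponential satisfies a first-order recursion.\<close>

locale commuting_ops =
  fixes A :: "nat \<Rightarrow> V0 \<Rightarrow> V0"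
  assumes A_add: "A i (p + q) = A i p + A i q"
    and A_scale: "A i (scale0 c p) = scale0 c (A i p)"
    and A_comm: "A i (A j p) = A j (A i p)"
begin

lemma A_0 [simp]: "A i 0 = 0"
  using A_scale[of i 0 0] by simp

lemma A_sum: "A i (sum f S) = (\<Sum>x\<in>S. A i (f x))"
  by (induction S rule: infinite_finite_induct) (simp_all add: A_add)

lemma op_pow_add: "op_pow A k n (p + q) = op_pow A k n p + op_pow A k n q"
  by (induction k arbitrary: n) (simp_all add: A_add sum.distrib)

lemma op_pow_scale: "op_pow A k n (scale0 c p) = scale0 c (op_pow A k n p)"
  by (induction k arbitrary: n) (simp_all add: A_scale V0C.scale_sum_right)

lemma op_exp_add: "op_exp A n (p + q) = op_exp A n p + op_exp A n q"
  by (simp add: op_exp_def op_pow_add V0C.scale_right_distrib sum.distrib)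

lemma op_exp_scale: "op_exp A n (scale0 c p) = scale0 c (op_exp A n p)"
  by (simp add: op_exp_def op_pow_scale V0C.scale_sum_right mult.commute)

lemma op_exp_0 [simp]: "op_exp A n 0 = 0"
  using op_exp_scale[of n 0 0] by simp

lemma op_exp_sum: "op_exp A n (sum f S) = (\<Sum>x\<in>S. op_exp A n (f x))"
  by (induction S rule: infinite_finite_induct) (simp_all add: op_exp_add)

lemma op_pow_eq_0: "n < k \<Longrightarrow> op_pow A k n p = 0"
  by (induction k arbitrary: n) (auto intro!: sum.neutral)

text \<open>The logarithmic derivative identity for \<open>A(w)\<^sup>k\<^sup>+\<^sup>1\<close>.\<close>

lemma op_pow_rec:
  "scale0 (of_nat n) (op_pow A (Suc k) n p) =
     scale0 (of_nat (Suc k)) (\<Sum>i=1..n. scale0 (of_nat i) (A i (op_pow A k (n - i) p)))"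
proof (induction k arbitrary: n)
  case 0
  have "scale0 (of_nat n) (A i (if n - i = 0 then p else 0)) =
      scale0 (of_nat i) (A i (if n - i = 0 then p else 0))" if "i \<in> {1..n}" for i
    using that by (cases "i = n") auto
  then have "(\<Sum>i=1..n. scale0 (of_nat n) (A i (if n - i = 0 then p else 0))) =
      (\<Sum>i=1..n. scale0 (of_nat i) (A i (if n - i = 0 then p else 0)))"
    by (rule sum.cong[OF refl])
  then show ?case
    by (simp add: V0C.scale_sum_right)
next
  case (Suc k)
  \<comment> \<open>Leibniz rule: the weight n splits as i + (n - i). The first part differentiates
    the outermost factor, the second the remaining power, to which the induction hypothesis
    applies.\<close>
  have "scale0 (of_nat n) (op_pow A (Suc (Suc k)) n p) =
      (\<Sum>i=1..n. scale0 (of_nat i + of_nat (n - i)) (A i (op_pow A (Suc k) (n - i) p)))"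
    unfolding op_pow.simps(2)[of A "Suc k"] V0C.scale_sum_right
    by (intro sum.cong) (auto simp: of_nat_diff)
  also have "\<dots> = (\<Sum>i=1..n. scale0 (of_nat i) (A i (op_pow A (Suc k) (n - i) p))) +
      (\<Sum>i=1..n. A i (scale0 (of_nat (n - i)) (op_pow A (Suc k) (n - i) p)))"
    unfolding V0C.scale_left_distrib sum.distrib A_scale ..
  also have "(\<Sum>i=1..n. A i (scale0 (of_nat (n - i)) (op_pow A (Suc k) (n - i) p))) =
      scale0 (of_nat (Suc k)) (\<Sum>i=1..n. \<Sum>j=1..n-i.
        scale0 (of_nat j) (A i (A j (op_pow A k (n - i - j) p))))"
    unfolding Suc.IH A_scale A_sum V0C.scale_sum_right by simp
  also have "(\<Sum>i=1..n. \<Sum>j=1..n-i. scale0 (of_nat j) (A i (A j (op_pow A k (n - i - j) p)))) =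
      (\<Sum>j=1..n. \<Sum>i=1..n-j. scale0 (of_nat j) (A i (A j (op_pow A k (n - i - j) p))))"
    by (rule sum_nested_swap)
  also have "\<dots> = (\<Sum>j=1..n. scale0 (of_nat j) (A j (op_pow A (Suc k) (n - j) p)))"
    unfolding op_pow.simps(2) A_sum V0C.scale_sum_right
    by (intro sum.cong refl, subst A_comm) (simp only: diff_commute)
  finally show ?case
    unfolding of_nat_Suc[of "Suc k"] V0C.scale_left_distrib V0C.scale_one .
qed

lemma op_exp_zero_idx [simp]: "op_exp A 0 p = p"
  by (simp add: op_exp_def)

text \<open>Coefficients of w d/dw exp(A(w)) = (w A'(w)) exp(A(w)), obtained by summing
  \<open>op_pow_rec\<close> with the weights 1/k!.\<close>

lemma op_exp_rec:
  "scale0 (of_nat n) (op_exp A n p) =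
     (\<Sum>i=1..n. scale0 (of_nat i) (A i (op_exp A (n - i) p)))"
proof (cases n)
  case (Suc n')
  \<comment> \<open>Raising the cutoff only adds terms with k > m, which vanish. A common cutoff
    allows the sums over k and i to be interchanged.\<close>
  have ext: "op_exp A m p = (\<Sum>k\<le>n'. scale0 (1 / fact k) (op_pow A k m p))" if "m \<le> n'" for m
    unfolding op_exp_def by (rule sum.mono_neutral_left) (use that in \<open>auto simp: op_pow_eq_0\<close>)
  have "scale0 (of_nat n) (op_exp A n p) =
      (\<Sum>k\<le>n. scale0 (1 / fact k) (scale0 (of_nat n) (op_pow A k n p)))"
    by (simp add: op_exp_def V0C.scale_sum_right mult.commute)
  also have "\<dots> = (\<Sum>k\<le>n'. scale0 (1 / fact (Suc k)) (scale0 (of_nat n) (op_pow A (Suc k) n p)))"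
    unfolding Suc sum.atMost_Suc_shift by (simp add: Suc del: op_pow.simps) simp
  also have "\<dots> = (\<Sum>k\<le>n'. \<Sum>i=1..n. scale0 (of_nat i) (A i (scale0 (1 / fact k) (op_pow A k (n - i) p))))"
    unfolding op_pow_rec V0C.scale_sum_right A_scale
    by (intro sum.cong refl) (simp add: field_simps del: of_nat_Suc)
  also have "\<dots> = (\<Sum>i=1..n. scale0 (of_nat i) (A i (\<Sum>k\<le>n'. scale0 (1 / fact k) (op_pow A k (n - i) p))))"
    by (subst sum.swap) (simp add: A_sum V0C.scale_sum_right)
  also have "\<dots> = (\<Sum>i=1..n. scale0 (of_nat i) (A i (op_exp A (n - i) p)))"
    proof (intro sum.cong refl)
    fix i
    assume "i \<in> {1..n}"
    then have "n - i \<le> n'"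
      using Suc by auto
    then show "scale0 (of_nat i) (A i (\<Sum>k\<le>n'. scale0 (1 / fact k) (op_pow A k (n - i) p))) =
        scale0 (of_nat i) (A i (op_exp A (n - i) p))"
      by (simp only: ext)
  qed
  finally show ?thesis .
qed simp

text \<open>For n > 0 the factor n is invertible, so the recursion determines all coefficients from
  the one at 0. Closed forms of exponentials are verified by checking their recursion.\<close>

lemma op_exp_unique:
  assumes "f 0 = p"
    and "\<And>n. scale0 (of_nat n) (f n) = (\<Sum>i=1..n. scale0 (of_nat i) (A i (f (n - i))))"
  shows "op_exp A n p = f n"
proof (induction n rule: less_induct)
  case (less n)
  show ?case
  proof (cases "n = 0")
    case False
    have "scale0 (of_nat n) (op_exp A n p) = scale0 (of_nat n) (f n)"
      unfolding op_exp_rec assms(2) by (intro sum.cong refl) (simp add: less.IH)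
    then show ?thesis
      using False scale0_of_nat_cancel by blast
  qed (simp add: assms)
qed

end

text \<open>The exponential of a derivation is an algebra homomorphism: the convolution product
  satisfies the recursion that characterises the left-hand side.\<close>

lemma op_exp_mult:
  assumes "commuting_ops A" and "\<And>i p q. i > 0 \<Longrightarrow> A i (p * q) = A i p * q + p * A i q"
  shows "op_exp A n (p * q) = (\<Sum>i\<le>n. op_exp A i p * op_exp A (n - i) q)"
proof -
  interpret commuting_ops A by fact
  let ?e = "op_exp A"
  \<comment> \<open>The half of the derivative that falls on the first factor. The other half
    follows by exchanging p and q and reversing the summation.\<close>
  have left: "(\<Sum>i\<le>n. scale0 (of_nat i) (?e i p) * ?e (n - i) q) =
      (\<Sum>j=1..n. scale0 (of_nat j) (\<Sum>i\<le>n-j. A j (?e i p) * ?e (n - j - i) q))" for n p q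
  proof -
    have "(\<Sum>i\<le>n. scale0 (of_nat i) (?e i p) * ?e (n - i) q) =
        (\<Sum>i\<le>n. \<Sum>j=1..i. scale0 (of_nat j) (A j (?e (i - j) p)) * ?e (n - i) q)"
      unfolding op_exp_rec sum_distrib_right ..
    also have "\<dots> = (\<Sum>j=1..n. \<Sum>i\<le>n-j. scale0 (of_nat j) (A j (?e i p)) * ?e (n - j - i) q)"
      unfolding sum.Sigma[OF finite_atMost ballI[OF finite_atLeastAtMost]]
        sum.Sigma[OF finite_atLeastAtMost ballI[OF finite_atMost]]
      by (rule sum.reindex_bij_witness[where i="\<lambda>(j, i). (i + j, j)" and j="\<lambda>(i, j). (j, i - j)"])
        auto
    finally show ?thesis
      by (simp add: V0C.scale_sum_right scale0_mult_left)
  qed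
  show ?thesis
  proof (rule op_exp_unique, goal_cases)
    case (2 n)
    have "scale0 (of_nat n) (\<Sum>i\<le>n. ?e i p * ?e (n - i) q) =
        (\<Sum>i\<le>n. scale0 (of_nat i + of_nat (n - i)) (?e i p * ?e (n - i) q))"
      unfolding V0C.scale_sum_right by (intro sum.cong) (auto simp: of_nat_diff)
    also have "\<dots> = (\<Sum>i\<le>n. scale0 (of_nat i) (?e i p) * ?e (n - i) q) +
        (\<Sum>i\<le>n. ?e i p * scale0 (of_nat (n - i)) (?e (n - i) q))"
      unfolding V0C.scale_left_distrib sum.distrib scale0_mult_left scale0_mult_right ..
    also have "(\<Sum>i\<le>n. ?e i p * scale0 (of_nat (n - i)) (?e (n - i) q)) =
        (\<Sum>i\<le>n. scale0 (of_nat i) (?e i q) * ?e (n - i) p)"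
      by (rule sum.reindex_bij_witness[where i="\<lambda>i. n - i" and j="\<lambda>i. n - i"])
        (auto simp: mult.commute)
    also have "\<dots> = (\<Sum>j=1..n. scale0 (of_nat j) (\<Sum>i\<le>n-j. A j (?e i q) * ?e (n - j - i) p))"
      by (rule left)
    also have "\<dots> = (\<Sum>j=1..n. scale0 (of_nat j) (\<Sum>i\<le>n-j. ?e i p * A j (?e (n - j - i) q)))"
    proof (rule sum.cong[OF refl], rule arg_cong[where f="scale0 _"])
      fix j
      have "(\<Sum>i\<le>m. A j (?e i q) * ?e (m - i) p) = (\<Sum>i\<le>m. ?e i p * A j (?e (m - i) q))" for m
        by (rule sum.reindex_bij_witness[where i="\<lambda>i. m - i" and j="\<lambda>i. m - i"])
          (auto simp: mult.commute)
      then show "(\<Sum>i\<le>n-j. A j (?e i q) * ?e (n - j - i) p) =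
          (\<Sum>i\<le>n-j. ?e i p * A j (?e (n - j - i) q))" .
    qed
    finally have "scale0 (of_nat n) (\<Sum>i\<le>n. ?e i p * ?e (n - i) q) =
        (\<Sum>j=1..n. scale0 (of_nat j) (\<Sum>i\<le>n-j. A j (?e i p) * ?e (n - j - i) q)) +
        (\<Sum>j=1..n. scale0 (of_nat j) (\<Sum>i\<le>n-j. ?e i p * A j (?e (n - j - i) q)))"
      unfolding left .
    also have "\<dots> = (\<Sum>j=1..n. scale0 (of_nat j) (A j (\<Sum>i\<le>n-j. ?e i p * ?e (n - j - i) q)))"
      unfolding sum.distrib[symmetric] V0C.scale_right_distrib[symmetric]
    proof (rule sum.cong[OF refl], rule arg_cong[where f="scale0 _"])
      fix j
      assume "j \<in> {1..n}"
      then show "(\<Sum>i\<le>n-j. A j (?e i p) * ?e (n - j - i) q + ?e i p * A j (?e (n - j - i) q)) =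
          A j (\<Sum>i\<le>n-j. ?e i p * ?e (n - j - i) q)"
        using assms(2)[of j] unfolding A_sum by (intro sum.cong refl) (simp only: atLeastAtMost_iff, simp)
    qed
    finally show ?case .
  qed simp
qed

section \<open>The two exponential factors on the \<open>H\<^sub>n\<close>\<close>

lemma poly_mapping_sum_single:
  "(\<Sum>u\<in>Poly_Mapping.keys p. Poly_Mapping.single u (Poly_Mapping.lookup p u)) = p"
  by (rule poly_mapping_eqI)
    (auto simp: lookup_sum lookup_single when_def sum.delta in_keys_iff)

lemma poly_mapping_single_add_induct [case_names single add]:
  fixes p :: "'a \<Rightarrow>\<^sub>0 'b :: comm_monoid_add"
  assumes single: "\<And>u c. P (Poly_Mapping.single u c)"
    and add: "\<And>p q. P p \<Longrightarrow> P q \<Longrightarrow> P (p + q)"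
  shows "P p"
proof -
  have "P (\<Sum>u\<in>S. Poly_Mapping.single u (Poly_Mapping.lookup p u))" if "finite S" for S
    using that
  proof (induction S rule: finite_induct)
    case empty
    show ?case
      using single[of undefined 0] by simp
  qed (simp add: single add)
  from this[of "Poly_Mapping.keys p"] show ?thesis
    by (simp add: poly_mapping_sum_single)
qed

text \<open>The truncated subtraction in \<open>dh\<close> also sends monomials without the variable
  to some monomial, but with coefficient 0. So the coefficient at v comes only from v times the
  variable.\<close>

lemma lookup_dh:
  "Poly_Mapping.lookup (dh n p) v =
     of_nat (Poly_Mapping.lookup v (n - 1) + 1) *
       Poly_Mapping.lookup p (v + Poly_Mapping.single (n - 1) 1)"
proof -
  let ?e = "Poly_Mapping.single (n - 1) 1 :: nat \<Rightarrow>\<^sub>0 nat"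
  let ?c = "\<lambda>u. of_nat (Poly_Mapping.lookup u (n - 1)) * Poly_Mapping.lookup p u"
  have "u = v + ?e" if "u - ?e = v" "Poly_Mapping.lookup u (n - 1) \<noteq> 0" for u
    using that by (intro poly_mapping_eqI) (auto simp: lookup_add lookup_minus lookup_single when_def)
  moreover have "v + ?e - ?e = v"
    by simp
  ultimately have "Poly_Mapping.lookup (dh n p) v =
      (\<Sum>u\<in>Poly_Mapping.keys p. if u = v + ?e then ?c u else 0)"
    unfolding dh_def lookup_sum lookup_single when_def
    by (intro sum.cong refl) (metis mult_zero_left of_nat_0)
  then show ?thesis
    by (simp add: sum.delta in_keys_iff lookup_add)
qed

lemma dh_add: "dh n (p + q) = dh n p + dh n q"
  by (rule poly_mapping_eqI) (simp add: lookup_dh lookup_add algebra_simps)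

lemma dh_scale: "dh n (scale0 c p) = scale0 c (dh n p)"
  by (rule poly_mapping_eqI) (simp add: lookup_dh lookup_scale0 algebra_simps)

lemma dh_comm: "dh m (dh n p) = dh n (dh m p)"
  by (cases "m - 1 = n - 1"; rule poly_mapping_eqI)
    (simp_all add: lookup_dh lookup_add lookup_single when_def ac_simps)

lemma dh_0 [simp]: "dh n 0 = 0"
  by (simp add: dh_def)

lemma dh_sum: "dh n (sum f S) = (\<Sum>x\<in>S. dh n (f x))"
  by (induction S rule: infinite_finite_induct) (simp_all add: dh_add)

lemma dh_single:
  "dh n (Poly_Mapping.single u c) = Poly_Mapping.single (u - Poly_Mapping.single (n - 1) 1)
     (of_nat (Poly_Mapping.lookup u (n - 1)) * c)"
  by (cases "c = 0") (simp_all add: dh_def)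

lemma dh_mult: "dh n (p * q) = dh n p * q + p * dh n q"
proof (induction p rule: poly_mapping_single_add_induct)
  case (single u a)
  show ?case
  proof (induction q rule: poly_mapping_single_add_induct)
    case (single v b)
    let ?e = "Poly_Mapping.single (n - 1) 1 :: nat \<Rightarrow>\<^sub>0 nat"
    \<comment> \<open>Truncated subtraction is compatible with adding v if the variable occurs in u;
      otherwise the coefficient in front is 0.\<close>
    have *: "u + v - ?e = u - ?e + v" if "Poly_Mapping.lookup u (n - 1) \<noteq> 0" for u v
      using that
      by (intro poly_mapping_eqI) (auto simp: lookup_add lookup_minus lookup_single when_def)
    have "Poly_Mapping.single (u + v - ?e) (of_nat (Poly_Mapping.lookup u (n - 1)) * a * b) =
        Poly_Mapping.single (u - ?e + v) (of_nat (Poly_Mapping.lookup u (n - 1)) * a * b)"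
      using *[of u v] by (cases "Poly_Mapping.lookup u (n - 1) = 0") auto
    moreover have "Poly_Mapping.single (u + v - ?e) (of_nat (Poly_Mapping.lookup v (n - 1)) * a * b) =
        Poly_Mapping.single (u + (v - ?e)) (of_nat (Poly_Mapping.lookup v (n - 1)) * a * b)"
      using *[of v u] by (cases "Poly_Mapping.lookup v (n - 1) = 0") (auto simp: add.commute)
    ultimately show ?case
      by (simp add: dh_single mult_single lookup_add algebra_simps single_add)
  qed (simp add: dh_add algebra_simps)
qed (simp add: dh_add algebra_simps)

text \<open>Positivity keeps the encoding faithful: \<open>n - 1\<close> truncates, so the indices 0
  and 1 name the same variable.\<close>

lemma dh_hvar:
  assumes "m > 0" "n > 0"
  shows "dh m (hvar n) = (if m = n then 1 else 0)"
  using assms by (auto simp: hvar_def dh_single lookup_single when_def)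

section \<open>Partitions and the recursion for \<open>H\<close>\<close>

lemma finite_partitions: "finite (partitions n)"
proof -
  have "size \<nu> \<le> sum_mset \<nu>" if "0 \<notin># \<nu>" for \<nu> :: "nat multiset"
    using that by (induction \<nu>) auto
  moreover have "i \<le> sum_mset \<nu>" if "i \<in># \<nu>" for i and \<nu> :: "nat multiset"
    using that by (metis le_add1 multi_member_split sum_mset.add_mset)
  ultimately have "mset (sorted_list_of_multiset \<nu>) = \<nu> \<and>
      set (sorted_list_of_multiset \<nu>) \<subseteq> {..n} \<and> length (sorted_list_of_multiset \<nu>) \<le> n"
    if "\<nu> \<in> partitions n" for \<nu>
    using that by (auto simp: partitions_def simp flip: size_mset)
  then have "partitions n \<subseteq> mset ` {xs. set xs \<subseteq> {..n} \<and> length xs \<le> n}"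
    by (metis (mono_tags, lifting) image_eqI mem_Collect_eq subsetI)
  then show ?thesis
    by (rule finite_subset) (intro finite_imageI finite_lists_length_le finite_atMost)
qed

lemma zee_superset:
  assumes "finite S" "set_mset \<nu> \<subseteq> S"
  shows "zee \<nu> = (\<Prod>i\<in>S. i ^ count \<nu> i * fact (count \<nu> i))"
  unfolding zee_def
  by (rule prod.mono_neutral_left) (use assms in \<open>auto simp: not_in_iff\<close>)

lemma zee_add_mset: "zee (add_mset i \<nu>) = zee \<nu> * (i * Suc (count \<nu> i))"
proof -
  let ?S = "insert i (set_mset \<nu>)"
  have "zee (add_mset i \<nu>) = i ^ Suc (count \<nu> i) * fact (Suc (count \<nu> i)) *
      (\<Prod>j\<in>?S - {i}. j ^ count \<nu> j * fact (count \<nu> j))"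
    by (subst zee_superset[of ?S], simp, simp, subst prod.remove[of _ i]) auto
  moreover have "zee \<nu> = i ^ count \<nu> i * fact (count \<nu> i) *
      (\<Prod>j\<in>?S - {i}. j ^ count \<nu> j * fact (count \<nu> j))"
    by (subst zee_superset[of ?S], simp, blast, subst prod.remove[of _ i]) auto
  ultimately show ?thesis
    by (simp only: power_Suc fact_Suc of_nat_id ac_simps)
qed

lemma zee_pos: "0 \<notin># \<nu> \<Longrightarrow> zee \<nu> > 0"
  unfolding zee_def by (intro prod_pos) (metis fact_gt_zero mult_pos_pos neq0_conv zero_less_power)

definition H_term :: "nat \<Rightarrow> nat multiset \<Rightarrow> V0" where
  "H_term \<alpha> \<nu> = scale0 (of_nat \<alpha> ^ size \<nu> * inverse (of_nat (zee \<nu>))) (\<Prod>i\<in>#\<nu>. hvar i)"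

lemma H_of_nat: "H \<alpha> (int n) = (\<Sum>\<nu>\<in>partitions n. H_term \<alpha> \<nu>)"
  by (simp add: H_def H_term_def)

lemma H_neg: "n < 0 \<Longrightarrow> H \<alpha> n = 0"
  by (simp add: H_def)

lemma partitions_0: "partitions 0 = {{#}}"
  by (auto simp: partitions_def) (metis multiset_nonemptyE)

lemma H_0: "H \<alpha> 0 = 1"
  using H_of_nat[of \<alpha> 0] by (simp add: partitions_0 H_term_def zee_def)

text \<open>Inserting a part i multiplies \<open>zee\<close> by i times the new multiplicity of i,
  which is exactly the weight on the left. What remains is one factor \<alpha> and one
  variable.\<close>

lemma H_term_add_mset:
  assumes "i > 0" "0 \<notin># \<nu>"
  shows "scale0 (of_nat (i * count (add_mset i \<nu>) i)) (H_term \<alpha> (add_mset i \<nu>)) =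
    scale0 (of_nat \<alpha>) (hvar i * H_term \<alpha> \<nu>)"
proof -
  have "of_nat (i * count (add_mset i \<nu>) i) *
      (of_nat \<alpha> ^ size (add_mset i \<nu>) * inverse (of_nat (zee (add_mset i \<nu>)))) =
      of_nat \<alpha> * (of_nat \<alpha> ^ size \<nu> * inverse (of_nat (zee \<nu>)) :: complex)"
    using assms zee_pos[OF assms(2)]
    by (simp add: zee_add_mset del: of_nat_Suc mult_Suc_right)
      (simp add: divide_simps del: of_nat_Suc)
  then show ?thesis
    unfolding H_term_def scale0_mult_right V0C.scale_scale by simp
qed

lemma sum_mult_count:
  fixes \<nu> :: "nat multiset"
  assumes "finite S" "set_mset \<nu> \<subseteq> S"
  shows "(\<Sum>i\<in>S. i * count \<nu> i) = sum_mset \<nu>"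
  using assms(2)
proof (induction \<nu>)
  case (add x \<nu>)
  have "(\<Sum>i\<in>S. i * count (add_mset x \<nu>) i) = (\<Sum>i\<in>S. i * count \<nu> i + (if i = x then x else 0))"
    by (intro sum.cong) auto
  then show ?case
    using add assms(1) by (simp add: sum.distrib)
qed simp

text \<open>Removing one part \<open>i\<close> from a partition \<open>\<nu>\<close> of \<open>n\<close>, with weight \<open>i\<close> times the multiplicity
  of \<open>i\<close>, where these weights add up to \<open>n\<close>.\<close>

lemma H_rec_nat:
  "scale0 (of_nat n) (H \<alpha> (int n)) =
     (\<Sum>i=1..n. scale0 (of_nat \<alpha>) (hvar i * H \<alpha> (int (n - i))))"
proof -
  have "scale0 (of_nat \<alpha>) (hvar i * H \<alpha> (int (n - i))) =
      (\<Sum>\<nu>\<in>partitions n. scale0 (of_nat (i * count \<nu> i)) (H_term \<alpha> \<nu>))" if i: "i \<in> {1..n}" for i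
  proof -
    have "scale0 (of_nat \<alpha>) (hvar i * H \<alpha> (int (n - i))) =
        (\<Sum>\<nu>\<in>partitions (n - i). scale0 (of_nat (i * count (add_mset i \<nu>) i)) (H_term \<alpha> (add_mset i \<nu>)))"
      unfolding H_of_nat sum_distrib_left V0C.scale_sum_right using i
      by (intro sum.cong refl H_term_add_mset[symmetric]) (auto simp: partitions_def)
    also have "\<dots> = (\<Sum>\<nu>\<in>{\<nu>\<in>partitions n. i \<in># \<nu>}. scale0 (of_nat (i * count \<nu> i)) (H_term \<alpha> \<nu>))"
      using i
      by (intro sum.reindex_bij_witness[where i="\<lambda>\<nu>. \<nu> - {#i#}" and j="add_mset i"])
        (auto simp: partitions_def sum_mset_diff dest: in_diffD)
    also have "\<dots> = (\<Sum>\<nu>\<in>partitions n. scale0 (of_nat (i * count \<nu> i)) (H_term \<alpha> \<nu>))"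
      by (rule sum.mono_neutral_left) (auto simp: finite_partitions not_in_iff)
    finally show ?thesis .
  qed
  then have "(\<Sum>i=1..n. scale0 (of_nat \<alpha>) (hvar i * H \<alpha> (int (n - i)))) =
      (\<Sum>\<nu>\<in>partitions n. scale0 (of_nat (\<Sum>i=1..n. i * count \<nu> i)) (H_term \<alpha> \<nu>))"
    by (simp add: V0C.scale_sum_left) (rule sum.swap)
  also have "\<dots> = (\<Sum>\<nu>\<in>partitions n. scale0 (of_nat n) (H_term \<alpha> \<nu>))"
  proof (intro sum.cong refl arg_cong2[where f=scale0] arg_cong[where f=of_nat])
    fix \<nu> assume \<nu>: "\<nu> \<in> partitions n"
    have "i \<in> {1..n}" if "i \<in># \<nu>" for i
    proof -
      have "i \<le> sum_mset \<nu>"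
        using that by (metis le_add1 multi_member_split sum_mset.add_mset)
      then show ?thesis
        using that \<nu> by (cases i) (auto simp: partitions_def)
    qed
    then show "(\<Sum>i=1..n. i * count \<nu> i) = n"
      using \<nu> by (subst sum_mult_count) (auto simp: partitions_def)
  qed
  finally show ?thesis
    by (simp add: H_of_nat V0C.scale_sum_right)
qed

text \<open>Any N \<ge> n may serve as upper limit, because the extra terms have a negative index
  and vanish. In \<open>dh_H\<close> the recursion is used with such a longer range.\<close>

lemma H_rec:
  assumes "n \<le> int N"
  shows "scale0 (of_int n) (H \<alpha> n) = (\<Sum>i=1..N. scale0 (of_nat \<alpha>) (hvar i * H \<alpha> (n - int i)))"
proof (cases "n < 0")
  case False
  then have "scale0 (of_int n) (H \<alpha> n) =
      (\<Sum>i=1..nat n. scale0 (of_nat \<alpha>) (hvar i * H \<alpha> (int (nat n - i))))"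
    using H_rec_nat[of "nat n" \<alpha>] by simp
  also have "\<dots> = (\<Sum>i=1..N. scale0 (of_nat \<alpha>) (hvar i * H \<alpha> (n - int i)))"
    using assms False
    by (intro sum.mono_neutral_cong_left) (auto simp: H_neg of_nat_diff nat_le_iff)
  finally show ?thesis .
qed (simp add: H_neg)

text \<open>\<open>H_rec_nat\<close> is the recursion of the exponential whose coefficients are the
  multiplications by \<alpha> h_{-n} / n.\<close>

lemma E_neg_eq: "E_neg \<alpha> n p = H \<alpha> (int n) * p"
proof -
  let ?A = "\<lambda>n p. scale0 (1 / of_nat n * of_nat \<alpha>) (h_neg n p)"
  interpret commuting_ops ?A
    by standard (simp_all add: h_neg_def algebra_simps scale0_mult_right V0C.scale_right_distrib)
  show ?thesis
    unfolding E_neg_def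
  proof (rule op_exp_unique, goal_cases)
    case (2 n)
    show ?case
      unfolding scale0_mult_left[symmetric] H_rec_nat sum_distrib_right
      by (intro sum.cong refl) (simp add: h_neg_def scale0_mult_left mult.assoc)
  qed (simp add: H_0)
qed

text \<open>Differentiating exp (sum of \<alpha> h_{-n} w^n / n) with respect to h_{-i} multiplies
  it by \<alpha> w^i / i. Coefficientwise this is an induction along \<open>H_rec\<close>.\<close>

lemma dh_H:
  assumes "i > 0"
  shows "dh i (H \<alpha> n) = scale0 (of_nat \<alpha> / of_nat i) (H \<alpha> (n - int i))"
proof (cases "n < 0")
  case False
  then obtain m where n: "n = int m"
    by (metis nonneg_int_cases not_less)
  show ?thesis
    unfolding n
  proof (induction m rule: less_induct)
    case (less m)
    show ?case
    proof (cases "m = 0")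
      case True
      then show ?thesis
        using assms dh_single[of i 0 1] by (simp add: H_0 H_neg)
    next
      case False
      let ?a = "of_nat \<alpha> :: complex" and ?b = "of_nat \<alpha> / of_nat i :: complex"
      have "scale0 (of_nat m) (dh i (H \<alpha> (int m))) =
          (\<Sum>j=1..m. scale0 ?a (dh i (hvar j) * H \<alpha> (int m - int j))) +
          (\<Sum>j=1..m. scale0 ?a (hvar j * dh i (H \<alpha> (int m - int j))))"
      proof -
        have "scale0 (of_nat m) (dh i (H \<alpha> (int m))) = dh i (scale0 (of_int (int m)) (H \<alpha> (int m)))"
          by (simp add: dh_scale)
        also have "\<dots> = dh i (\<Sum>j=1..m. scale0 ?a (hvar j * H \<alpha> (int m - int j)))"
          by (subst H_rec[of _ m]) simp_all
        finally show ?thesis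
          by (simp only: dh_sum dh_scale dh_mult V0C.scale_right_distrib sum.distrib)
      qed
      also have "(\<Sum>j=1..m. scale0 ?a (dh i (hvar j) * H \<alpha> (int m - int j))) =
          (\<Sum>j=1..m. if j = i then scale0 ?a (H \<alpha> (int m - int i)) else 0)"
        using assms by (intro sum.cong refl) (auto simp: dh_hvar)
      \<comment> \<open>If i > m, no summand has j = i, and the right-hand side is 0 because its
        index is negative.\<close>
      also have "\<dots> = scale0 ?a (H \<alpha> (int m - int i))"
        using assms by (auto simp: H_neg)
      also have "(\<Sum>j=1..m. scale0 ?a (hvar j * dh i (H \<alpha> (int m - int j)))) =
          scale0 ?b (\<Sum>j=1..m. scale0 ?a (hvar j * H \<alpha> (int m - int i - int j)))"
        unfolding V0C.scale_sum_right
      proof (intro sum.cong refl)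
        fix j assume "j \<in> {1..m}"
        then have "dh i (H \<alpha> (int m - int j)) = scale0 ?b (H \<alpha> (int m - int i - int j))"
          unfolding cancel_ab_semigroup_add_class.diff_right_commute[of "int m" "int i"] using less.IH[of "m - j"] by (simp add: of_nat_diff)
        then show "scale0 ?a (hvar j * dh i (H \<alpha> (int m - int j))) =
            scale0 ?b (scale0 ?a (hvar j * H \<alpha> (int m - int i - int j)))"
          by (simp only: scale0_mult_right V0C.scale_left_commute)
      qed
      also have "\<dots> = scale0 ?b (scale0 (of_int (int m - int i)) (H \<alpha> (int m - int i)))"
        using H_rec[of "int m - int i" m \<alpha>] by simp
      \<comment> \<open>The scalars combine as \<alpha> + (\<alpha>/i)(m - i) = m
        \<alpha>/i.\<close>
      also have "scale0 ?a (H \<alpha> (int m - int i)) + \<dots> =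
          scale0 (of_nat m) (scale0 ?b (H \<alpha> (int m - int i)))"
        using assms unfolding V0C.scale_scale V0C.scale_left_distrib[symmetric]
        by (intro arg_cong2[where f=scale0] refl) (simp add: divide_simps, simp add: algebra_simps)
      finally show ?thesis
        using False scale0_of_nat_cancel[of m] by blast
    qed
  qed
qed (simp add: H_neg)

section \<open>The right exponential factor\<close>

abbreviation E_pos_op :: "nat \<Rightarrow> nat \<Rightarrow> V0 \<Rightarrow> V0" where
  "E_pos_op \<alpha> n p \<equiv> scale0 (1 / (- of_nat n) * (2 * of_nat \<alpha>)) (h_pos \<alpha> n p)"

text \<open>The scalars \<alpha> and n in \<open>h_pos\<close> cancel against those of the exponent,
  which leaves a multiple of a derivation.\<close>

lemma E_pos_op_eq: "\<alpha> > 0 \<Longrightarrow> n > 0 \<Longrightarrow> E_pos_op \<alpha> n p = scale0 (- 2) (dh n p)"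
  by (simp add: h_pos_def)

interpretation E_pos: commuting_ops "E_pos_op \<alpha>"
  rewrites "op_exp (E_pos_op \<alpha>) = E_pos \<alpha>" for \<alpha>
proof -
  show "commuting_ops (E_pos_op \<alpha>)"
    unfolding h_pos_def
  proof
    show "scale0 c (scale0 d (dh i (scale0 c' (scale0 d' (dh j p))))) =
        scale0 c' (scale0 d' (dh j (scale0 c (scale0 d (dh i p)))))" for c d c' d' i j p
      unfolding dh_scale V0C.scale_scale by (subst dh_comm) (simp only: ac_simps)
  qed (simp_all add: dh_add dh_scale V0C.scale_right_distrib mult.commute)
qed (simp add: E_pos_def)

lemma E_pos_mult:
  assumes "\<alpha> > 0"
  shows "E_pos \<alpha> n (p * q) = (\<Sum>i\<le>n. E_pos \<alpha> i p * E_pos \<alpha> (n - i) q)"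
  unfolding E_pos_def
proof (rule op_exp_mult)
  show "commuting_ops (E_pos_op \<alpha>)"
    by (rule E_pos.commuting_ops_axioms)
qed (simp only: E_pos_op_eq[OF assms] dh_mult V0C.scale_right_distrib scale0_mult_left scale0_mult_right)

text \<open>\<open>raise_coeff \<alpha> j\<close> is the coefficient of \<open>x\<^sup>j\<close> in \<open>(1 - x)\<^sup>2\<^sup>\<alpha>\<close>.\<close>

definition raise_coeff :: "nat \<Rightarrow> nat \<Rightarrow> rat" where
  "raise_coeff \<alpha> j = (- 1) ^ j * (of_nat (2 * \<alpha>) gchoose j)"

lemma raise_coeff_0 [simp]: "raise_coeff \<alpha> 0 = 1"
  by (simp add: raise_coeff_def)

lemma raise_coeff_eq_0: "2 * \<alpha> < j \<Longrightarrow> raise_coeff \<alpha> j = 0"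
  by (simp add: raise_coeff_def binomial_gbinomial[symmetric] del: of_nat_mult)

text \<open>Logarithmic derivative of P = (1 - x)^(2\<alpha>), namely x P' = -2\<alpha> (x + x^2 +
  ...) P.\<close>

lemma raise_coeff_rec:
  "of_nat j * raise_coeff \<alpha> j = - of_nat (2 * \<alpha>) * (\<Sum>i=1..j. raise_coeff \<alpha> (j - i))"
proof (cases j)
  case (Suc m)
  have "(\<Sum>i=1..j. raise_coeff \<alpha> (j - i)) = (\<Sum>i\<le>m. (of_nat (2 * \<alpha>) gchoose i) * (- 1) ^ i)"
    unfolding Suc
    by (rule sum.reindex_bij_witness[where i="\<lambda>i. Suc m - i" and j="\<lambda>i. Suc m - i"])
      (auto simp: raise_coeff_def)
  also have "\<dots> = (- 1) ^ m * (of_nat (2 * \<alpha>) - 1 gchoose m)"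
    by (rule gbinomial_sum_lower_neg)
  finally have "- of_nat (2 * \<alpha>) * (\<Sum>i=1..j. raise_coeff \<alpha> (j - i)) =
      (- 1) ^ Suc m * (of_nat (2 * \<alpha>) * (of_nat (2 * \<alpha>) - 1 gchoose m))"
    by simp
  also have "\<dots> = of_nat j * raise_coeff \<alpha> j"
    unfolding gbinomial_absorption[symmetric] raise_coeff_def Suc by (rule mult.left_commute)
  finally show ?thesis ..
qed simp

text \<open>In the exponential recursion for the right-hand side, all terms are multiples of the
  same \<open>H\<close>, with index n - j, by \<open>dh_H\<close>. The scalars then agree by
  \<open>raise_coeff_rec\<close>.\<close>

lemma E_pos_H:
  assumes "\<alpha> > 0"
  shows "E_pos \<alpha> j (H \<alpha> n) = scale0 (of_rat (raise_coeff \<alpha> j)) (H \<alpha> (n - int j))"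
proof (rule E_pos.op_exp_unique, goal_cases)
  case (2 j)
  have "scale0 (of_nat j) (scale0 (of_rat (raise_coeff \<alpha> j)) (H \<alpha> (n - int j))) =
      scale0 (of_rat (of_nat j * raise_coeff \<alpha> j)) (H \<alpha> (n - int j))"
    by (simp add: of_rat_mult)
  also have "\<dots> = (\<Sum>i=1..j. scale0 (- of_nat (2 * \<alpha>) * of_rat (raise_coeff \<alpha> (j - i))) (H \<alpha> (n - int j)))"
    unfolding raise_coeff_rec
    by (simp only: of_rat_mult of_rat_minus of_rat_sum of_rat_of_nat_eq sum_distrib_left
        V0C.scale_sum_left)
  also have "\<dots> = (\<Sum>i=1..j. scale0 (of_nat i)
      (E_pos_op \<alpha> i (scale0 (of_rat (raise_coeff \<alpha> (j - i))) (H \<alpha> (n - int (j - i))))))"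
  proof (intro sum.cong refl)
    fix i assume "i \<in> {1..j}"
    then have "i > 0" and "n - int (j - i) - int i = n - int j"
      by auto
    then show "scale0 (- of_nat (2 * \<alpha>) * of_rat (raise_coeff \<alpha> (j - i))) (H \<alpha> (n - int j)) =
        scale0 (of_nat i)
          (E_pos_op \<alpha> i (scale0 (of_rat (raise_coeff \<alpha> (j - i))) (H \<alpha> (n - int (j - i)))))"
      unfolding E_pos_op_eq[OF assms \<open>i > 0\<close>] dh_scale dh_H[OF \<open>i > 0\<close>] by simp
  qed
  finally show ?case .
qed simp

section \<open>The dominance expansion\<close>

text \<open>Zero entries are allowed: the entry at a position records by how much the index there is
  lowered.\<close>

definition compositions :: "nat \<Rightarrow> nat \<Rightarrow> nat list set" where
  "compositions l n = {js. length js = l \<and> sum_list js = n}"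

lemma finite_compositions: "finite (compositions l n)"
proof (rule finite_subset)
  show "compositions l n \<subseteq> {js. set js \<subseteq> {..n} \<and> length js = l}"
    by (auto simp: compositions_def member_le_sum_list)
qed (intro finite_lists_length_eq finite_atMost)

lemma compositions_0: "compositions 0 n = (if n = 0 then {[]} else {})"
  by (auto simp: compositions_def)

lemma sum_compositions_Suc:
  "(\<Sum>js\<in>compositions (Suc l) n. f js) = (\<Sum>i\<le>n. \<Sum>js\<in>compositions l (n - i). f (i # js))"
  unfolding sum.Sigma[OF finite_atMost ballI[OF finite_compositions]]
  by (rule sum.reindex_bij_witness[where i="\<lambda>(i, js). i # js" and j="\<lambda>js. (hd js, tl js)"])
    (auto simp: compositions_def length_Suc_conv)

definition lower :: "int list \<Rightarrow> nat list \<Rightarrow> int list" where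
  "lower s js = map2 (\<lambda>x j. x - int j) s js"

lemma lower_Nil [simp]: "lower [] js = []"
  and lower_Cons [simp]: "lower (x # s) (j # js) = (x - int j) # lower s js"
  by (simp_all add: lower_def)

lemma length_lower [simp]: "length js = length s \<Longrightarrow> length (lower s js) = length s"
  by (simp add: lower_def)

lemma lower_zeros: "length js = length s \<Longrightarrow> sum_list js = 0 \<Longrightarrow> lower s js = s"
  by (induction js s rule: list_induct2) auto

lemma sum_list_take_lower:
  "length js = length s \<Longrightarrow>
     sum_list (take i (lower s js)) = sum_list (take i s) - int (sum_list (take i js))"
proof (induction js s arbitrary: i rule: list_induct2)
  case (Cons j js x s)
  then show ?case
    by (cases i) auto
qed simp

definition raise_coeffs :: "nat \<Rightarrow> nat list \<Rightarrow> rat" where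
  "raise_coeffs \<alpha> js = prod_list (map (raise_coeff \<alpha>) js)"

lemma H_list_Nil [simp]: "H_list \<alpha> [] = 1"
  and H_list_Cons [simp]: "H_list \<alpha> (x # s) = H \<alpha> x * H_list \<alpha> s"
  by (simp_all add: H_list_def)

text \<open>By \<open>E_pos_mult\<close> the j units are distributed over the factors in all
  possible ways, and \<open>E_pos_H\<close> evaluates each factor.\<close>

lemma E_pos_H_list:
  assumes "\<alpha> > 0"
  shows "E_pos \<alpha> j (H_list \<alpha> s) = (\<Sum>js\<in>compositions (length s) j.
    scale0 (of_rat (raise_coeffs \<alpha> js)) (H_list \<alpha> (lower s js)))"
proof (induction s arbitrary: j)
  case Nil
  show ?case
    \<comment> \<open>The constant 1 is \<open>H\<close> at index 0. For j > 0 the formula leads to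
      the negative index -j, hence to 0.\<close>
    using E_pos_H[OF assms, of j 0] by (simp add: compositions_0 raise_coeffs_def H_0 H_neg)
next
  case (Cons x s)
  have "E_pos \<alpha> j (H_list \<alpha> (x # s)) =
      (\<Sum>i\<le>j. scale0 (of_rat (raise_coeff \<alpha> i)) (H \<alpha> (x - int i)) *
        (\<Sum>js\<in>compositions (length s) (j - i).
          scale0 (of_rat (raise_coeffs \<alpha> js)) (H_list \<alpha> (lower s js))))"
    by (simp only: H_list_Cons E_pos_mult[OF assms] E_pos_H[OF assms] Cons.IH)
  then show ?case
    by (simp add: sum_compositions_Suc sum_distrib_left raise_coeffs_def scale0_mult_left
        scale0_mult_right of_rat_mult mult.commute)
qed

text \<open>Pigeonhole: more than 2\<alpha> units per factor on average force an entry above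
  2\<alpha>, the degree of (1 - x)^(2\<alpha>). The bound depends on the list only through its
  length and cuts off the sum in \<open>X_mode\<close>.\<close>

lemma E_pos_H_list_eq_0:
  assumes "\<alpha> > 0" "2 * \<alpha> * length s < j"
  shows "E_pos \<alpha> j (H_list \<alpha> s) = 0"
  unfolding E_pos_H_list[OF assms(1)]
proof (intro sum.neutral ballI)
  fix js assume js: "js \<in> compositions (length s) j"
  have "\<exists>i\<in>set js. 2 * \<alpha> < i"
  proof (rule ccontr)
    assume "\<not> ?thesis"
    then have "sum_list js \<le> length js * (2 * \<alpha>)"
      by (induction js) auto
    then show False
      using js assms(2) by (simp add: compositions_def mult.commute)
  qed
  then have "raise_coeffs \<alpha> js = 0"
    unfolding raise_coeffs_def prod_list_zero_iff by (auto intro!: image_eqI simp: raise_coeff_eq_0)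
  then show "scale0 (of_rat (raise_coeffs \<alpha> js)) (H_list \<alpha> (lower s js)) = 0"
    by simp
qed

text \<open>The exponent condition determines i from j. When the required i is negative,
  \<open>X_mode\<close> has no such term, and \<open>H\<close> is 0 at that index.\<close>

lemma X_mode_tensor:
  assumes "\<And>j. N < j \<Longrightarrow> E_pos \<alpha> j p = 0"
  shows "X_mode \<alpha> (- n) (tensor p k) =
    tensor (\<Sum>j\<le>N. H \<alpha> (n - (k + 1) * int \<alpha> + int j) * E_pos \<alpha> j p) (k + 2)"
proof (cases "p = 0")
  case False
  let ?i = "\<lambda>j. n - (k + 1) * int \<alpha> + int j"
  let ?f = "\<lambda>(i, j). if int i + (k + 1) * int \<alpha> - int j = n then E_neg \<alpha> i (E_pos \<alpha> j p) else 0"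
  have "Sum_any ?f = sum ?f ((\<lambda>j. (nat (?i j), j)) ` {..N})"
  proof (rule Sum_any.expand_superset)
    show "{a. ?f a \<noteq> 0} \<subseteq> (\<lambda>j. (nat (?i j), j)) ` {..N}"
    proof
      fix x
      assume x: "x \<in> {a. ?f a \<noteq> 0}"
      obtain i j where [simp]: "x = (i, j)"
        by (cases x)
      from x have "int i + (k + 1) * int \<alpha> - int j = n" "E_pos \<alpha> j p \<noteq> 0"
        by (auto simp: E_neg_eq split: if_splits)
      then have "i = nat (?i j)" "j \<le> N"
        using assms[of j] by (auto simp: not_less[symmetric])
      then show "x \<in> (\<lambda>j. (nat (?i j), j)) ` {..N}"
        by simp
    qed
  qed simp
  also have "\<dots> = (\<Sum>j\<le>N. ?f (nat (?i j), j))"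
    by (subst sum.reindex) (auto simp: inj_on_def)
  also have "\<dots> = (\<Sum>j\<le>N. H \<alpha> (?i j) * E_pos \<alpha> j p)"
    by (intro sum.cong refl) (auto simp: E_neg_eq H_neg)
  finally show ?thesis
    using False unfolding X_mode_def tensor_def keys_single by (simp add: lookup_single_eq cong: if_cong)
qed (simp add: X_mode_def tensor_def)

section \<open>Shifts, raising and dominance\<close>

definition offsets :: "nat \<Rightarrow> int \<Rightarrow> nat \<Rightarrow> int list" where
  "offsets \<alpha> k l = map (\<lambda>i. (k + 1) * int \<alpha> + 2 * int \<alpha> * int i) (rev [0..<l])"

lemma length_offsets [simp]: "length (offsets \<alpha> k l) = l"
  by (simp add: offsets_def)

lemma offsets_0 [simp]: "offsets \<alpha> k 0 = []"
  and offsets_Suc [simp]: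
    "offsets \<alpha> k (Suc l) = ((k + 1) * int \<alpha> + 2 * int \<alpha> * int l) # offsets \<alpha> k l"
  by (simp_all add: offsets_def)

text \<open>The shift of the definitions, for an arbitrary charge \<open>k/2\<close>.\<close>

definition shift :: "nat \<Rightarrow> int \<Rightarrow> int list \<Rightarrow> int list" where
  "shift \<alpha> k \<mu> = map2 (-) \<mu> (offsets \<alpha> k (length \<mu>))"

lemma length_shift [simp]: "length (shift \<alpha> k \<mu>) = length \<mu>"
  by (simp add: shift_def)

lemma shift_Nil [simp]: "shift \<alpha> k [] = []"
  and shift_Cons [simp]: "shift \<alpha> k (x # \<mu>) =
    (x - (k + 1) * int \<alpha> - 2 * int \<alpha> * int (length \<mu>)) # shift \<alpha> k \<mu>"
  by (simp_all add: shift_def)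

lemma shifted_eq_shift: "shifted \<alpha> m \<mu> = shift \<alpha> (2 * m) \<mu>"
  by (rule nth_equalityI) (auto simp: shifted_def shift_def offsets_def rev_nth)

lemma shift_lower:
  "length js = length \<mu> \<Longrightarrow> shift \<alpha> k (lower \<mu> js) = lower (shift \<alpha> k \<mu>) js"
  by (induction js \<mu> rule: list_induct2) auto

text \<open>The effect of one mode on the indices: the units \<open>js\<close> taken from the
  entries of \<mu> are collected in the new leading entry.\<close>

definition raise :: "int \<Rightarrow> int list \<times> nat list \<Rightarrow> int list" where
  "raise n = (\<lambda>(\<mu>, js). (n + int (sum_list js)) # lower \<mu> js)"

lemma dominates_refl: "dominates \<mu> \<mu>"
  by (simp add: dominates_def)

lemma sum_list_take_le: "sum_list (take i js) \<le> sum_list (js :: nat list)"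
  by (metis append_take_drop_id le_add1 sum_list_append)

text \<open>Each nonempty partial sum gains all units of \<open>js\<close> at the head and loses
  only those of the entries it covers.\<close>

lemma dominates_raise:
  assumes "dominates \<mu> \<nu>" "length js = length \<mu>"
  shows "dominates (raise n (\<mu>, js)) (n # \<nu>)"
proof -
  have "sum_list (lower \<mu> js) = sum_list \<mu> - int (sum_list js)"
    using sum_list_take_lower[OF assms(2), of "length \<mu>"] assms(2) by simp
  moreover have "sum_list (take i (n # \<nu>)) \<le> sum_list (take i (raise n (\<mu>, js)))"
    if "i \<le> Suc (length \<nu>)" for i
  proof (cases i)
    case (Suc i')
    then have "sum_list (take i' \<nu>) \<le> sum_list (take i' \<mu>)"
      using assms that by (simp add: dominates_def)
    moreover have "int (sum_list (take i' js)) \<le> int (sum_list js)"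
      using sum_list_take_le by (simp only: of_nat_le_iff)
    ultimately show ?thesis
      using sum_list_take_lower[OF assms(2), of i'] Suc by (simp add: raise_def)
  qed simp
  ultimately show ?thesis
    using assms by (simp add: dominates_def raise_def)
qed

text \<open>This yields the leading coefficient 1: only one pair produces n # \<nu>, the one that
  leaves \<nu> unchanged.\<close>

lemma raise_eq_Cons_iff:
  assumes "length js = length \<mu>"
  shows "raise n (\<mu>, js) = n # \<nu> \<longleftrightarrow> \<mu> = \<nu> \<and> js = replicate (length \<nu>) 0"
proof
  assume *: "raise n (\<mu>, js) = n # \<nu>"
  then have "sum_list js = 0"
    by (simp add: raise_def)
  with * show "\<mu> = \<nu> \<and> js = replicate (length \<nu>) 0"
    using assms lower_zeros[OF assms] by (auto simp: raise_def intro: replicate_eqI)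
next
  assume "\<mu> = \<nu> \<and> js = replicate (length \<nu>) 0"
  then show "raise n (\<mu>, js) = n # \<nu>"
    using lower_zeros[of js \<mu>] by (simp add: raise_def sum_list_replicate)
qed

text \<open>The factor created by the mode has index n - (k + 2l + 1)\<alpha> + j, which is the
  leading entry of the shifted raised list when j is the sum of \<open>js\<close>. The charge l
  gained so far thus accounts for the summand 2\<alpha>\<delta> of the shift. \<open>J\<close>
  consists of the lowerings within the cutoff of \<open>E_pos_H_list_eq_0\<close>.\<close>

lemma X_mode_H_lists:
  fixes S :: "int list set" and a :: "int list \<Rightarrow> rat"
  assumes "\<alpha> > 0" and S: "finite S" "\<And>\<mu>. \<mu> \<in> S \<Longrightarrow> length \<mu> = l"
  defines "J \<equiv> {js. length js = l \<and> sum_list js \<le> 2 * \<alpha> * l}"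
  shows "X_mode \<alpha> (- n)
      (tensor (\<Sum>\<mu>\<in>S. scale0 (of_rat (a \<mu>)) (H_list \<alpha> (shift \<alpha> k \<mu>))) (k + 2 * int l)) =
    tensor (\<Sum>(\<mu>, js)\<in>S \<times> J. scale0 (of_rat (a \<mu> * raise_coeffs \<alpha> js))
      (H_list \<alpha> (shift \<alpha> k (raise n (\<mu>, js))))) (k + 2 * int (Suc l))"
proof -
  let ?N = "2 * \<alpha> * l"
  let ?p = "\<Sum>\<mu>\<in>S. scale0 (of_rat (a \<mu>)) (H_list \<alpha> (shift \<alpha> k \<mu>))"
  let ?h = "\<lambda>j. H \<alpha> (n - (k + 2 * int l + 1) * int \<alpha> + int j)"
  have E: "E_pos \<alpha> j ?p = (\<Sum>\<mu>\<in>S. scale0 (of_rat (a \<mu>)) (E_pos \<alpha> j (H_list \<alpha> (shift \<alpha> k \<mu>))))" for j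
    by (simp add: E_pos.op_exp_sum E_pos.op_exp_scale)
  have "(\<Sum>j\<le>?N. ?h j * E_pos \<alpha> j ?p) =
      (\<Sum>\<mu>\<in>S. \<Sum>j\<le>?N. \<Sum>js\<in>compositions l j. scale0 (of_rat (a \<mu> * raise_coeffs \<alpha> js))
        (?h j * H_list \<alpha> (lower (shift \<alpha> k \<mu>) js)))"
    unfolding E sum_distrib_left
    by (subst sum.swap, intro sum.cong refl)
      (simp add: E_pos_H_list[OF assms(1)] S sum_distrib_left scale0_mult_right V0C.scale_sum_right
        of_rat_mult)
  also have "\<dots> = (\<Sum>\<mu>\<in>S. \<Sum>js\<in>J. scale0 (of_rat (a \<mu> * raise_coeffs \<alpha> js))
        (?h (sum_list js) * H_list \<alpha> (lower (shift \<alpha> k \<mu>) js)))"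
    unfolding sum.Sigma[OF finite_atMost ballI[OF finite_compositions]]
    by (intro sum.cong refl
        sum.reindex_bij_witness[where i="\<lambda>js. (sum_list js, js)" and j=snd])
      (auto simp: J_def compositions_def)
  also have "\<dots> = (\<Sum>\<mu>\<in>S. \<Sum>js\<in>J. scale0 (of_rat (a \<mu> * raise_coeffs \<alpha> js))
      (H_list \<alpha> (shift \<alpha> k (raise n (\<mu>, js)))))"
    by (intro sum.cong refl)
      (auto simp: J_def S raise_def shift_lower algebra_simps)
  also have "\<dots> = (\<Sum>(\<mu>, js)\<in>S \<times> J. scale0 (of_rat (a \<mu> * raise_coeffs \<alpha> js))
      (H_list \<alpha> (shift \<alpha> k (raise n (\<mu>, js)))))"
    by (rule sum.cartesian_product)
  finally show ?thesis
    by (subst X_mode_tensor[where N="?N"])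
      (simp_all add: E E_pos_H_list_eq_0[OF assms(1)] S algebra_simps)
qed

lemma X_neg_Cons: "X_neg \<alpha> (n # \<nu>) v = X_mode \<alpha> (- n) (X_neg \<alpha> \<nu> v)"
  by (simp add: X_neg_def)

text \<open>\<open>S\<close> and \<open>a\<close> are chosen before k: the coefficients are built
  from \<open>raise_coeffs\<close>, and the charge enters through the shift alone.\<close>

lemma X_neg_expansion:
  assumes "\<alpha> > 0"
  shows "\<exists>S (a :: int list \<Rightarrow> rat). finite S \<and> (\<forall>\<mu>\<in>S. dominates \<mu> \<nu>) \<and> \<nu> \<in> S \<and> a \<nu> = 1 \<and>
    (\<forall>k. X_neg \<alpha> \<nu> (exph k) =
      tensor (\<Sum>\<mu>\<in>S. scale0 (of_rat (a \<mu>)) (H_list \<alpha> (shift \<alpha> k \<mu>))) (k + 2 * int (length \<nu>)))"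
proof (induction \<nu>)
  case Nil
  show ?case
    by (intro exI[of _ "{[]}"] exI[of _ "\<lambda>_. 1"]) (simp add: dominates_refl X_neg_def exph_def)
next
  case (Cons n \<nu>)
  then obtain S and a :: "int list \<Rightarrow> rat" where
    S: "finite S" "\<And>\<mu>. \<mu> \<in> S \<Longrightarrow> dominates \<mu> \<nu>" "\<nu> \<in> S" "a \<nu> = 1" and
    X: "\<And>k. X_neg \<alpha> \<nu> (exph k) =
      tensor (\<Sum>\<mu>\<in>S. scale0 (of_rat (a \<mu>)) (H_list \<alpha> (shift \<alpha> k \<mu>))) (k + 2 * int (length \<nu>))"
    by blast
  define l where "l = length \<nu>"
  have len: "length \<mu> = l" if "\<mu> \<in> S" for \<mu>
    using S(2)[OF that] by (simp add: dominates_def l_def)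
  define J where "J = {js. length js = l \<and> sum_list js \<le> 2 * \<alpha> * l}"
  have "J = (\<Union>n\<le>2 * \<alpha> * l. compositions l n)"
    by (auto simp: J_def compositions_def)
  then have J: "finite (S \<times> J)"
    using S(1) by (simp add: finite_compositions)
  \<comment> \<open>Different pairs may be raised to the same list, so the coefficients are added
    over the fibres of \<open>raise n\<close>.\<close>
  define b where
    "b \<mu>' = (\<Sum>(\<mu>, js)\<in>{x \<in> S \<times> J. raise n x = \<mu>'}. a \<mu> * raise_coeffs \<alpha> js)" for \<mu>'
  have zeros: "replicate l 0 \<in> J" and coeff: "raise_coeffs \<alpha> (replicate l 0) = 1"
    by (simp_all add: J_def sum_list_replicate raise_coeffs_def)
  have iff: "raise n (\<mu>, js) = n # \<nu> \<longleftrightarrow> \<mu> = \<nu> \<and> js = replicate l 0" if "\<mu> \<in> S" "js \<in> J" for \<mu> js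
    using raise_eq_Cons_iff[of js \<mu> n \<nu>] that len by (auto simp: J_def l_def)
  then have fib: "{x \<in> S \<times> J. raise n x = n # \<nu>} = {(\<nu>, replicate l 0)}"
    using S(3) zeros by auto
  show ?case
  proof (intro exI[of _ "raise n ` (S \<times> J)"] exI[of _ b] conjI allI ballI)
    show "finite (raise n ` (S \<times> J))"
      using J by (rule finite_imageI)
    show "dominates \<mu>' (n # \<nu>)" if "\<mu>' \<in> raise n ` (S \<times> J)" for \<mu>'
      using that S(2) len by (auto simp: J_def intro: dominates_raise)
    show "n # \<nu> \<in> raise n ` (S \<times> J)"
      using iff[OF S(3) zeros] S(3) zeros by (metis SigmaI image_eqI)
    show "b (n # \<nu>) = 1"
      by (simp add: b_def fib S(4) coeff)
    show "X_neg \<alpha> (n # \<nu>) (exph k) =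
        tensor (\<Sum>\<mu>\<in>raise n ` (S \<times> J). scale0 (of_rat (b \<mu>)) (H_list \<alpha> (shift \<alpha> k \<mu>)))
          (k + 2 * int (length (n # \<nu>)))" for k
    proof -
      have "(\<Sum>\<mu>'\<in>raise n ` (S \<times> J). scale0 (of_rat (b \<mu>')) (H_list \<alpha> (shift \<alpha> k \<mu>'))) =
          (\<Sum>\<mu>'\<in>raise n ` (S \<times> J). \<Sum>x\<in>{x \<in> S \<times> J. raise n x = \<mu>'}.
            scale0 (of_rat (a (fst x) * raise_coeffs \<alpha> (snd x))) (H_list \<alpha> (shift \<alpha> k (raise n x))))"
        by (intro sum.cong refl)
          (simp add: b_def of_rat_sum V0C.scale_sum_left case_prod_unfold)
      also have "\<dots> = (\<Sum>x\<in>S \<times> J.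
          scale0 (of_rat (a (fst x) * raise_coeffs \<alpha> (snd x))) (H_list \<alpha> (shift \<alpha> k (raise n x))))"
        using J by (intro sum.group) auto
      finally show ?thesis
        using X_mode_H_lists[OF assms S(1) len, of n a k]
        by (simp add: X_neg_Cons X l_def J_def case_prod_unfold)
    qed
  qed
qed

section \<open>Spanning\<close>

lemma tensor_0 [simp]: "tensor 0 k = 0"
  by (simp add: tensor_def)

lemma tensor_add: "tensor (p + q) k = tensor p k + tensor q k"
  by (simp add: tensor_def single_add)

lemma tensor_sum: "tensor (sum f S) k = (\<Sum>x\<in>S. tensor (f x) k)"
  by (induction S rule: infinite_finite_induct) (simp_all add: tensor_add)

lemma tensor_scale0: "tensor (scale0 c p) k = scaleV c (tensor p k)"
  by (simp add: tensor_def scaleV_def scale0_def mult_single)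

lemma tensor_scale0_of_rat: "tensor (scale0 (of_rat q) p) k = scaleF q (tensor p k)"
  by (simp add: tensor_scale0 scaleF_def)

text \<open>Rational scalars on \<open>V0\<close>, matching \<open>scaleF\<close> under
  \<open>tensor\<close>, so that rational spans in \<open>V0\<close> carry over to each charge of
  \<open>V\<close>.\<close>

definition scaleQ :: "rat \<Rightarrow> V0 \<Rightarrow> V0" where
  "scaleQ q p = scale0 (of_rat q) p"

global_interpretation V0Q: vector_space scaleQ
  by unfold_locales
    (simp_all add: scaleQ_def of_rat_add of_rat_mult V0C.scale_right_distrib V0C.scale_left_distrib)

lemma scaleQ_mult_left: "scaleQ c p * q = scaleQ c (p * q)"
  and scaleQ_mult_right: "p * scaleQ c q = scaleQ c (p * q)"
  by (simp_all add: scaleQ_def scale0_mult_left scale0_mult_right)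

lemma V0Q_span_mult:
  assumes "p \<in> V0Q.span A" "q \<in> V0Q.span B"
    and "\<And>a b. a \<in> A \<Longrightarrow> b \<in> B \<Longrightarrow> a * b \<in> V0Q.span C"
  shows "p * q \<in> V0Q.span C"
proof -
  have *: "a * q \<in> V0Q.span C" if "a \<in> A" for a
    using assms(2)
  proof (induction rule: V0Q.span_induct_alt)
    case (step c b r)
    then show ?case
      using assms(3)[OF that]
      by (simp add: distrib_left scaleQ_mult_right V0Q.span_add V0Q.span_scale)
  qed (simp add: V0Q.span_zero)
  show ?thesis
    using assms(1)
  proof (induction rule: V0Q.span_induct_alt)
    case (step c a r)
    then show ?case
      using * by (simp add: distrib_right scaleQ_mult_left V0Q.span_add V0Q.span_scale)
  qed (simp add: V0Q.span_zero)
qed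

lemma tensor_in_VF_span:
  assumes "p \<in> V0Q.span A" "\<And>a. a \<in> A \<Longrightarrow> tensor a k \<in> VF.span B"
  shows "tensor p k \<in> VF.span B"
  using assms(1)
proof (induction rule: V0Q.span_induct_alt)
  case (step c a r)
  then show ?case
    using assms(2)
    by (simp add: scaleQ_def tensor_add tensor_scale0_of_rat VF.span_add VF.span_scale)
qed (simp add: VF.span_zero)

definition H_span :: "nat \<Rightarrow> nat \<Rightarrow> V0 set" where
  "H_span \<alpha> n = V0Q.span {H_list \<alpha> s | s. (\<forall>x\<in>set s. 0 \<le> x) \<and> sum_list s = int n}"

lemma H_list_in_H_span:
  "(\<And>x. x \<in> set s \<Longrightarrow> 0 \<le> x) \<Longrightarrow> sum_list s = int n \<Longrightarrow> H_list \<alpha> s \<in> H_span \<alpha> n"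
  unfolding H_span_def by (rule V0Q.span_base) blast

lemma subspace_H_span: "V0Q.subspace (H_span \<alpha> n)"
  unfolding H_span_def by (rule V0Q.subspace_span)

lemma H_in_H_span: "H \<alpha> (int n) \<in> H_span \<alpha> n"
  using H_list_in_H_span[of "[int n]" n \<alpha>] by simp

lemma H_span_mult:
  assumes "p \<in> H_span \<alpha> m" "q \<in> H_span \<alpha> n"
  shows "p * q \<in> H_span \<alpha> (m + n)"
  using assms unfolding H_span_def
proof (rule V0Q_span_mult)
  fix a b
  assume "a \<in> {H_list \<alpha> s | s. (\<forall>x\<in>set s. 0 \<le> x) \<and> sum_list s = int m}"
    and "b \<in> {H_list \<alpha> s | s. (\<forall>x\<in>set s. 0 \<le> x) \<and> sum_list s = int n}"
  then obtain s t where "a = H_list \<alpha> s" "\<forall>x\<in>set s. 0 \<le> x" "sum_list s = int m"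
    and "b = H_list \<alpha> t" "\<forall>x\<in>set t. 0 \<le> x" "sum_list t = int n"
    by blast
  then show "a * b \<in> V0Q.span {H_list \<alpha> s | s. (\<forall>x\<in>set s. 0 \<le> x) \<and> sum_list s = int (m + n)}"
    using H_list_in_H_span[of "s @ t" "m + n" \<alpha>] by (auto simp: H_span_def H_list_def)
qed

text \<open>The term i = n of \<open>H_rec\<close> is \<alpha> h_{-n}, so the recursion can be
  solved for h_{-n}; the other terms are covered by induction.\<close>

lemma hvar_in_H_span:
  assumes "\<alpha> > 0" "n > 0"
  shows "hvar n \<in> H_span \<alpha> n"
  using assms(2)
proof (induction n rule: less_induct)
  case (less n)
  note closed = V0Q.subspace_scale[OF subspace_H_span] V0Q.subspace_diff[OF subspace_H_span]
    V0Q.subspace_sum[OF subspace_H_span]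
  have "scaleQ (of_nat n) (H \<alpha> (int n)) = (\<Sum>i=1..n. scaleQ (of_nat \<alpha>) (hvar i * H \<alpha> (int n - int i)))"
    using H_rec[of "int n" n \<alpha>] by (simp add: scaleQ_def)
  also have "\<dots> = scaleQ (of_nat \<alpha>) (hvar n) +
      (\<Sum>i\<in>{1..n} - {n}. scaleQ (of_nat \<alpha>) (hvar i * H \<alpha> (int n - int i)))"
    using less.prems by (subst sum.remove[of _ n]) (auto simp: H_0)
  finally have "scaleQ (of_nat \<alpha>) (hvar n) = scaleQ (of_nat n) (H \<alpha> (int n)) -
      (\<Sum>i\<in>{1..n} - {n}. scaleQ (of_nat \<alpha>) (hvar i * H \<alpha> (int n - int i)))"
    by simp
  also have "\<dots> \<in> H_span \<alpha> n"
  proof (intro closed H_in_H_span)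
    fix i assume i: "i \<in> {1..n} - {n}"
    then have "hvar i * H \<alpha> (int (n - i)) \<in> H_span \<alpha> (i + (n - i))"
      by (intro H_span_mult H_in_H_span less.IH) auto
    then show "hvar i * H \<alpha> (int n - int i) \<in> H_span \<alpha> n"
      using i by (simp add: of_nat_diff)
  qed
  finally have "scaleQ (inverse (of_nat \<alpha>)) (scaleQ (of_nat \<alpha>) (hvar n)) \<in> H_span \<alpha> n"
    by (rule closed)
  then show ?case
    using assms(1) by simp
qed

lemma prod_hvar_in_H_span:
  assumes "\<alpha> > 0" "0 \<notin># p"
  shows "(\<Prod>i\<in>#p. hvar i) \<in> H_span \<alpha> (sum_mset p)"
  using assms(2)
proof (induction p)
  case empty
  show ?case
    using H_in_H_span[of \<alpha> 0] by (simp add: H_0)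
next
  case (add i p)
  then show ?case
    using H_span_mult[OF hvar_in_H_span[OF assms(1), of i]] by auto
qed

text \<open>Summation by parts, with a carry \<open>c\<close> bounding the partial sums of the differences.\<close>

lemma sum_prod_diff_nonneg:
  fixes l \<mu> :: "int list"
  assumes "length \<mu> = length l" "sorted_wrt (\<ge>) l" "\<And>x. x \<in> set l \<Longrightarrow> x \<le> t"
    and "\<And>i. i \<le> length l \<Longrightarrow> 0 \<le> c + sum_list (take i \<mu>) - sum_list (take i l)"
    and "c + sum_list \<mu> = sum_list l"
  shows "0 \<le> c * t + sum_list (map2 (\<lambda>x y. x * (y - x)) l \<mu>)"
  using assms
proof (induction \<mu> l arbitrary: c t rule: list_induct2)
  case (Cons y \<mu> x l)
  have "0 \<le> c" "x \<le> t"
    using Cons.prems(3)[of 0] Cons.prems(2) by auto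
  then have "c * x \<le> c * t"
    by (rule mult_left_mono[rotated])
  \<comment> \<open>After the head the carry is c + y - x, and x bounds the remaining
    entries.\<close>
  moreover have "0 \<le> (c + y - x) * x + sum_list (map2 (\<lambda>x y. x * (y - x)) l \<mu>)"
  proof (rule Cons.IH)
    show "0 \<le> c + y - x + sum_list (take i \<mu>) - sum_list (take i l)" if "i \<le> length l" for i
      using Cons.prems(3)[of "Suc i"] that by simp
  qed (use Cons.prems in auto)
  ultimately show ?case
    by (simp add: algebra_simps)
qed simp

text \<open>Write \<mu> = \<nu> + d. The squares of \<mu> are those of \<nu>, plus twice the pairing
  of \<nu> with d, plus the squares of d. The pairing is nonnegative by summation by parts, and the
  last term is positive unless d = 0.\<close>

lemma sum_squares_less_of_dominates:
  assumes "dominates \<mu> \<nu>" "sorted_wrt (\<ge>) \<nu>" "\<mu> \<noteq> \<nu>"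
  shows "sum_list (map power2 \<nu>) < sum_list (map power2 \<mu>)"
proof -
  have len: "length \<mu> = length \<nu>"
    using assms(1) by (simp add: dominates_def)
  have "0 \<le> 0 * (if \<nu> = [] then 0 else hd \<nu>) + sum_list (map2 (\<lambda>x y. x * (y - x)) \<nu> \<mu>)"
    using assms(1,2) by (intro sum_prod_diff_nonneg) (auto simp: dominates_def neq_Nil_conv)
  moreover have "sum_list (map power2 \<nu>) + 2 * sum_list (map2 (\<lambda>x y. x * (y - x)) \<nu> \<mu>)
      \<le> sum_list (map power2 \<mu>) \<and>
      (\<mu> \<noteq> \<nu> \<longrightarrow> sum_list (map power2 \<nu>) + 2 * sum_list (map2 (\<lambda>x y. x * (y - x)) \<nu> \<mu>)
      < sum_list (map power2 \<mu>))"
    using len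
  proof (induction \<mu> \<nu> rule: list_induct2)
    case (Cons y \<mu> x \<nu>)
    have *: "y\<^sup>2 = x\<^sup>2 + 2 * (x * (y - x)) + (y - x)\<^sup>2"
      by (simp add: power2_eq_square algebra_simps)
    have "0 \<le> (y - x)\<^sup>2" "y \<noteq> x \<Longrightarrow> 0 < (y - x)\<^sup>2"
      by simp_all
    with Cons.IH show ?case
      by (simp only: list.map zip_Cons_Cons prod.case sum_list.Cons * distrib_left list.inject) linarith
  qed simp
  ultimately show ?thesis
    using assms(3) by simp
qed

text \<open>The upper bound that makes the induction on increasing sums of squares
  terminate.\<close>

lemma sum_squares_le_square_sum:
  fixes s :: "int list"
  assumes "\<And>x. x \<in> set s \<Longrightarrow> 0 \<le> x"
  shows "sum_list (map power2 s) \<le> (sum_list s)\<^sup>2"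
  using assms
proof (induction s)
  case (Cons x s)
  then have "0 \<le> x * sum_list s"
    by (intro mult_nonneg_nonneg sum_list_nonneg) auto
  then show ?case
    using Cons by (simp add: power2_sum)
qed simp

lemma dominates_shift:
  assumes "dominates \<mu> \<nu>"
  shows "dominates (shift \<alpha> k \<mu>) (shift \<alpha> k \<nu>)"
proof -
  have "sum_list (take i (map2 (-) xs ys)) = sum_list (take i xs) - sum_list (take i ys)"
    if "length xs = length ys" for i and xs ys :: "int list"
    using that
  proof (induction xs ys arbitrary: i rule: list_induct2)
    case (Cons x xs y ys)
    then show ?case
      by (cases i) auto
  qed simp
  then have *: "sum_list (take i (shift \<alpha> k \<mu>)) =
      sum_list (take i \<mu>) - sum_list (take i (offsets \<alpha> k (length \<mu>)))" for i \<mu>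
    by (simp add: shift_def)
  from *[of "length _"] have "sum_list (shift \<alpha> k \<mu>) = sum_list \<mu> - sum_list (offsets \<alpha> k (length \<mu>))" for \<mu>
    by (metis length_offsets length_shift order_refl take_all)
  then show ?thesis
    using assms by (simp add: dominates_def *)
qed

section \<open>Difference partitions and ordinary partitions\<close>

definition unshift :: "nat \<Rightarrow> int \<Rightarrow> int list \<Rightarrow> int list" where
  "unshift \<alpha> k s = map2 (+) s (offsets \<alpha> k (length s))"

lemma length_unshift [simp]: "length (unshift \<alpha> k s) = length s"
  by (simp add: unshift_def)

lemma shift_unshift [simp]: "shift \<alpha> k (unshift \<alpha> k s) = s"
  by (rule nth_equalityI) (simp_all add: shift_def unshift_def)

lemma unshift_shift [simp]: "unshift \<alpha> k (shift \<alpha> k \<nu>) = \<nu>"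
  by (rule nth_equalityI) (simp_all add: shift_def unshift_def)

lemma nth_unshift:
  "i < length s \<Longrightarrow> unshift \<alpha> k s ! i = s ! i + (k + 1) * int \<alpha> + 2 * int \<alpha> * int (length s - 1 - i)"
  by (simp add: unshift_def offsets_def rev_nth)

text \<open>The offsets drop by 2\<alpha> from entry to entry and end in (k + 1)\<alpha>. Removing
  them turns the gap condition into weak decrease and the lower bound into nonnegativity.\<close>

lemma unshift_in_diff_partitions_iff:
  "unshift \<alpha> k s \<in> diff_partitions \<alpha> k \<longleftrightarrow> sorted_wrt (\<ge>) s \<and> (\<forall>x\<in>set s. 0 \<le> x)"
proof -
  have "unshift \<alpha> k s ! i - unshift \<alpha> k s ! Suc i = s ! i - s ! Suc i + 2 * int \<alpha>"
    if "Suc i < length s" for i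
  proof -
    have "int (length s - 1 - i) = int (length s - 1 - Suc i) + 1"
      using that by auto
    then show ?thesis
      using that by (simp only: nth_unshift Suc_lessD) (simp add: algebra_simps)
  qed
  moreover have "last (unshift \<alpha> k s) = last s + (k + 1) * int \<alpha>" if "s \<noteq> []"
  proof -
    have "unshift \<alpha> k s \<noteq> []"
      using that by (metis length_0_conv length_unshift)
    then show ?thesis
      using that by (simp add: last_conv_nth nth_unshift)
  qed
  moreover have "unshift \<alpha> k s = [] \<longleftrightarrow> s = []"
    by (metis length_0_conv length_unshift)
  ultimately have "unshift \<alpha> k s \<in> diff_partitions \<alpha> k \<longleftrightarrow>
      (\<forall>i. Suc i < length s \<longrightarrow> s ! Suc i \<le> s ! i) \<and> (s \<noteq> [] \<longrightarrow> 0 \<le> last s)"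
    by (auto simp: diff_partitions_def)
  also have "(\<forall>i. Suc i < length s \<longrightarrow> s ! Suc i \<le> s ! i) \<longleftrightarrow> sorted_wrt (\<ge>) s"
    by (subst sorted_wrt_iff_nth_Suc_transp) (auto simp: transp_def)
  also have "sorted_wrt (\<ge>) s \<and> (s \<noteq> [] \<longrightarrow> 0 \<le> last s) \<longleftrightarrow> sorted_wrt (\<ge>) s \<and> (\<forall>x\<in>set s. 0 \<le> x)"
    by (cases s rule: rev_cases) (auto simp: sorted_wrt_append)
  finally show ?thesis .
qed

text \<open>On \<open>exph k\<close> the mode with the least admissible part (k + 1)\<alpha> merely
  raises the charge by 1. A trailing zero can therefore be traded for a larger starting charge,
  which is how different indices give the same product.\<close>

lemma X_neg_unshift_zeros:
  assumes "\<alpha> > 0"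
  shows "X_neg \<alpha> (unshift \<alpha> k (s @ replicate r 0)) (exph k) =
    X_neg \<alpha> (unshift \<alpha> (k + 2 * int r) s) (exph (k + 2 * int r))"
proof (induction r arbitrary: k)
  case (Suc r)
  have "offsets \<alpha> k (Suc l) = offsets \<alpha> (k + 2) l @ [(k + 1) * int \<alpha>]" for l
    by (induction l) (simp_all add: algebra_simps)
  then have "unshift \<alpha> k (s @ [0]) = unshift \<alpha> (k + 2) s @ [(k + 1) * int \<alpha>]" for s
    by (simp add: unshift_def)
  moreover have "X_mode \<alpha> (- ((k + 1) * int \<alpha>)) (exph k) = exph (k + 2)"
    using E_pos_H_list_eq_0[OF assms, of "[]"]
    by (subst exph_def, subst X_mode_tensor[where N=0]) (simp_all add: H_0 exph_def)
  ultimately have "X_neg \<alpha> (unshift \<alpha> k (s @ [0])) (exph k) =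
      X_neg \<alpha> (unshift \<alpha> (k + 2) s) (exph (k + 2))" for s
    by (simp add: X_neg_def)
  from this[of "s @ replicate r 0"] Suc.IH[of "k + 2"] show ?case
    by (simp add: replicate_append_same[symmetric] algebra_simps)
qed simp

definition part_list :: "nat multiset \<Rightarrow> int list" where
  "part_list p = rev (map int (sorted_list_of_multiset p))"

lemma length_part_list [simp]: "length (part_list p) = size p"
  by (simp add: part_list_def flip: size_mset)

lemma part_list_props:
  shows "sorted_wrt (\<ge>) (part_list p)" and "\<forall>x\<in>set (part_list p). 0 \<le> x"
    and "mset (part_list p) = image_mset int p"
  by (auto simp: part_list_def sorted_wrt_rev sorted_wrt_map)

text \<open>A normal form for p without zero parts. Here k is twice the final charge, and the
  starting charge is lower by the number of parts.\<close>

definition X_part :: "nat \<Rightarrow> int \<Rightarrow> nat multiset \<Rightarrow> V" where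
  "X_part \<alpha> k p = X_neg \<alpha> (unshift \<alpha> (k - 2 * int (size p)) (part_list p)) (exph (k - 2 * int (size p)))"

lemma sorted_desc_unique:
  fixes s t :: "int list"
  assumes "sorted_wrt (\<ge>) s" "sorted_wrt (\<ge>) t" "mset s = mset t"
  shows "s = t"
proof -
  have "rev s = rev t"
    using assms by (intro properties_for_sort[symmetric, THEN trans, OF _ _ properties_for_sort])
      (auto simp: sorted_wrt_rev)
  then show ?thesis
    by simp
qed

lemma X_neg_eq_X_part:
  assumes "\<alpha> > 0" "sorted_wrt (\<ge>) s" "\<And>x. x \<in> set s \<Longrightarrow> 0 \<le> x"
  obtains p where "0 \<notin># p" "int (sum_mset p) = sum_list s"
    "\<And>k. X_neg \<alpha> (unshift \<alpha> (k - 2 * int (length s)) s) (exph (k - 2 * int (length s))) = X_part \<alpha> k p"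
proof -
  define p where "p = filter_mset (\<lambda>i. i \<noteq> 0) (image_mset nat (mset s))"
  define r where "r = count (image_mset nat (mset s)) 0"
  have "p + replicate_mset r 0 = image_mset nat (mset s)"
    by (rule multiset_eqI) (auto simp: p_def r_def)
  then have "image_mset int p + replicate_mset r 0 = image_mset int (image_mset nat (mset s))"
    by (metis image_mset_union image_replicate_mset of_nat_0)
  also have "\<dots> = image_mset (\<lambda>x. x) (mset s)"
    unfolding multiset.map_comp by (intro image_mset_cong) (use assms(3) in auto)
  also have "\<dots> = mset s"
    by simp
  finally have mset: "image_mset int p + replicate_mset r 0 = mset s" .
  have "sorted_wrt (\<ge>) (replicate r (0 :: int))"
    by (induction r) auto
  then have s: "s = part_list p @ replicate r 0"
    using assms(2) mset part_list_props[of p]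
    by (intro sorted_desc_unique) (auto simp: sorted_wrt_append)
  show ?thesis
  proof
    show "0 \<notin># p"
      by (simp add: p_def)
    have "sum_list (part_list p) = int (sum_mset p)"
      by (simp add: part_list_props sum_mset_sum_list[symmetric])
    then show "int (sum_mset p) = sum_list s"
      by (simp add: s sum_list_replicate)
    show "X_neg \<alpha> (unshift \<alpha> (k - 2 * int (length s)) s) (exph (k - 2 * int (length s))) = X_part \<alpha> k p" for k
      unfolding s X_neg_unshift_zeros[OF assms(1)] by (simp add: X_part_def algebra_simps)
  qed
qed

text \<open>\<open>K\<close> is stable under shifts by 2, so starting charges and final charges run
  over the same set.\<close>

lemma products_eq:
  assumes "\<alpha> > 0" "\<And>k. k + 2 \<in> K \<longleftrightarrow> k \<in> K"
  shows "products \<alpha> K = (\<lambda>(k, p). X_part \<alpha> k p) ` (K \<times> {p. 0 \<notin># p})"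
proof -
  have K: "k + 2 * int n \<in> K \<longleftrightarrow> k \<in> K" for k n
  proof (induction n)
    case (Suc n)
    then show ?case
      using assms(2)[of "k + 2 * int n"] by (simp add: algebra_simps)
  qed simp
  show ?thesis
  proof (intro equalityI subsetI)
    fix v assume "v \<in> products \<alpha> K"
    then obtain \<nu> k where v: "v = X_neg \<alpha> \<nu> (exph k)" "k \<in> K" "\<nu> \<in> diff_partitions \<alpha> k"
      by (auto simp: products_def)
    let ?s = "shift \<alpha> k \<nu>"
    have "sorted_wrt (\<ge>) ?s" "\<forall>x\<in>set ?s. 0 \<le> x"
      using v(3) unshift_in_diff_partitions_iff[of \<alpha> k ?s] by auto
    then obtain p where "0 \<notin># p"
      "\<And>k. X_neg \<alpha> (unshift \<alpha> (k - 2 * int (length ?s)) ?s) (exph (k - 2 * int (length ?s))) = X_part \<alpha> k p"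
      using X_neg_eq_X_part[OF assms(1)] by blast
    from this(1) this(2)[of "k + 2 * int (length \<nu>)"] v(1,2)
    show "v \<in> (\<lambda>(k, p). X_part \<alpha> k p) ` (K \<times> {p. 0 \<notin># p})"
      by (auto simp: K intro!: image_eqI[of _ _ "(k + 2 * int (length \<nu>), p)"])
  next
    fix v assume "v \<in> (\<lambda>(k, p). X_part \<alpha> k p) ` (K \<times> {p. 0 \<notin># p})"
    then obtain k p where v: "v = X_part \<alpha> k p" "k \<in> K"
      by auto
    then show "v \<in> products \<alpha> K"
    proof -
      let ?k = "k - 2 * int (size p)"
      have "?k \<in> K" "unshift \<alpha> ?k (part_list p) \<in> diff_partitions \<alpha> ?k"
        using v K[of ?k "size p"] part_list_props[of p]
        by (auto simp: unshift_in_diff_partitions_iff)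
      then show ?thesis
        unfolding v(1) X_part_def products_def by blast
    qed
  qed
qed

lemma H_list_mset_cong: "mset s = mset t \<Longrightarrow> H_list \<alpha> s = H_list \<alpha> t"
  unfolding H_list_def by (metis mset_map prod_mset_prod_list)

lemma H_list_eq_0: "x \<in> set s \<Longrightarrow> x < 0 \<Longrightarrow> H_list \<alpha> s = 0"
  by (induction s) (auto simp: H_neg)

lemma tensor_H_list_in_span:
  assumes "\<alpha> > 0" "\<And>x. x \<in> set s \<Longrightarrow> 0 \<le> x" "sum_list s = int n"
  shows "tensor (H_list \<alpha> s) k \<in> VF.span (X_part \<alpha> k ` partitions n)"
  using assms(2,3)
\<comment> \<open>The measure falls because strict dominance increases the sum of squares, which is
  at most n^2 for nonnegative lists of sum n.\<close>
proof (induction "nat ((int n)\<^sup>2 - sum_list (map power2 s))" arbitrary: s rule: less_induct)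
  case less
  let ?W = "VF.span (X_part \<alpha> k ` partitions n)"
  define t where "t = rev (sort s)"
  have mset: "mset t = mset s"
    by (simp add: t_def)
  have sorted: "sorted_wrt (\<ge>) t"
    by (simp add: t_def sorted_wrt_rev)
  have sum: "sum_list t = int n"
    using less.prems(2) by (simp only: sum_mset_sum_list[symmetric] mset)
  have squares: "sum_list (map power2 t) = sum_list (map power2 s)"
    by (simp only: sum_mset_sum_list[symmetric] mset_map mset)
  have nonneg: "0 \<le> x" if "x \<in> set t" for x
    using that less.prems(1) mset_eq_setD[OF mset] by blast
  \<comment> \<open>With this starting charge the product ends in the component k.\<close>
  let ?k = "k - 2 * int (length t)"
  define \<nu> where "\<nu> = unshift \<alpha> ?k t"
  obtain S and a :: "int list \<Rightarrow> rat" where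
    S: "finite S" "\<forall>\<mu>\<in>S. dominates \<mu> \<nu>" "\<nu> \<in> S" "a \<nu> = 1" and
    X: "\<forall>k. X_neg \<alpha> \<nu> (exph k) =
      tensor (\<Sum>\<mu>\<in>S. scale0 (of_rat (a \<mu>)) (H_list \<alpha> (shift \<alpha> k \<mu>))) (k + 2 * int (length \<nu>))"
    using X_neg_expansion[OF assms(1), of \<nu>] by (elim exE conjE)
  obtain p where p: "0 \<notin># p" "int (sum_mset p) = sum_list t"
    "\<And>k. X_neg \<alpha> (unshift \<alpha> (k - 2 * int (length t)) t) (exph (k - 2 * int (length t))) = X_part \<alpha> k p"
    using nonneg that by (rule X_neg_eq_X_part[OF assms(1) sorted])
  have "X_part \<alpha> k p = (\<Sum>\<mu>\<in>S. scaleF (a \<mu>) (tensor (H_list \<alpha> (shift \<alpha> ?k \<mu>)) k))"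
    using X unfolding p(3)[symmetric] \<nu>_def[symmetric]
    by (simp add: tensor_sum tensor_scale0_of_rat) (simp add: \<nu>_def)
  also have "\<dots> = tensor (H_list \<alpha> t) k +
      (\<Sum>\<mu>\<in>S - {\<nu>}. scaleF (a \<mu>) (tensor (H_list \<alpha> (shift \<alpha> ?k \<mu>)) k))"
    using S by (subst sum.remove[of _ \<nu>]) (auto simp: \<nu>_def)
  finally have "tensor (H_list \<alpha> t) k = X_part \<alpha> k p -
      (\<Sum>\<mu>\<in>S - {\<nu>}. scaleF (a \<mu>) (tensor (H_list \<alpha> (shift \<alpha> ?k \<mu>)) k))"
    by simp
  also have "\<dots> \<in> ?W"
  proof (intro VF.span_diff VF.span_sum VF.span_scale)
    have "p \<in> partitions n"
      using p(1) trans[OF p(2) sum] unfolding partitions_def of_nat_eq_iff by blast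
    then show "X_part \<alpha> k p \<in> ?W"
      by (intro VF.span_base imageI)
    fix \<mu> assume \<mu>: "\<mu> \<in> S - {\<nu>}"
    let ?\<mu> = "shift \<alpha> ?k \<mu>"
    have "dominates ?\<mu> t"
      using \<mu> S(2) dominates_shift[of \<mu> \<nu> \<alpha> ?k] by (simp add: \<nu>_def)
    moreover have "?\<mu> \<noteq> t"
      using \<mu> unshift_shift[of \<alpha> ?k \<mu>] unfolding \<nu>_def by (metis DiffE singletonI)
    ultimately have less_squares: "sum_list (map power2 t) < sum_list (map power2 ?\<mu>)"
      by (rule sum_squares_less_of_dominates[OF _ sorted])
    have sum': "sum_list ?\<mu> = int n"
      using \<open>dominates ?\<mu> t\<close> sum by (simp only: dominates_def)
    show "tensor (H_list \<alpha> ?\<mu>) k \<in> ?W"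
    \<comment> \<open>The induction hypothesis covers nonnegative lists; a negative entry makes the
      product of \<open>H\<close> vanish.\<close>
    proof (cases "\<forall>x\<in>set ?\<mu>. 0 \<le> x")
      case True
      then have "sum_list (map power2 ?\<mu>) \<le> (int n)\<^sup>2"
        using sum_squares_le_square_sum[of ?\<mu>] sum' by simp
      then have "nat ((int n)\<^sup>2 - sum_list (map power2 ?\<mu>)) < nat ((int n)\<^sup>2 - sum_list (map power2 s))"
        using less_squares squares by linarith
      then show ?thesis
        using True sum' by (intro less.hyps) blast+
    next
      case False
      then show ?thesis
        using H_list_eq_0[of _ ?\<mu> \<alpha>] by (auto simp: not_le VF.span_zero)
    qed
  qed
  finally show ?case
    using H_list_mset_cong[OF mset] by simp
qed

lemma tensor_prod_hvar_in_span:
  assumes "\<alpha> > 0" "p \<in> partitions n"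
  shows "tensor (\<Prod>i\<in>#p. hvar i) k \<in> VF.span (X_part \<alpha> k ` partitions n)"
proof (rule tensor_in_VF_span)
  show "(\<Prod>i\<in>#p. hvar i) \<in> V0Q.span {H_list \<alpha> s | s. (\<forall>x\<in>set s. 0 \<le> x) \<and> sum_list s = int n}"
    using prod_hvar_in_H_span[OF assms(1), of p] assms(2) by (auto simp: partitions_def H_span_def)
qed (use tensor_H_list_in_span[OF assms(1)] in blast)

section \<open>Independence\<close>

definition exponents :: "nat multiset \<Rightarrow> nat \<Rightarrow>\<^sub>0 nat" where
  "exponents p = (\<Sum>i\<in>#p. Poly_Mapping.single (i - 1) 1)"

lemma prod_hvar: "(\<Prod>i\<in>#p. hvar i) = Poly_Mapping.single (exponents p) 1"
  by (induction p) (simp_all add: exponents_def hvar_def mult_single)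

lemma lookup_exponents:
  "0 \<notin># p \<Longrightarrow> Poly_Mapping.lookup (exponents p) i = count p (Suc i)"
  by (induction p) (auto simp: exponents_def lookup_add lookup_single when_def)

lemma inj_on_exponents: "inj_on exponents {p. 0 \<notin># p}"
proof (rule inj_onI)
  fix p q :: "nat multiset"
  assume *: "p \<in> {p. 0 \<notin># p}" "q \<in> {p. 0 \<notin># p}" "exponents p = exponents q"
  show "p = q"
  proof (rule multiset_eqI)
    fix i
    show "count p i = count q i"
      using * lookup_exponents[of p "i - 1"] lookup_exponents[of q "i - 1"]
      by (cases i) (auto simp: not_in_iff)
  qed
qed

text \<open>Together with injectivity this identifies the multisets of positive parts with the
  exponent vectors.\<close>

lemma exponents_surj:
  obtains p where "0 \<notin># p" "exponents p = u"
proof -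
  have "\<exists>p. 0 \<notin># p \<and> exponents p = u"
  proof (induction u rule: poly_mapping_single_add_induct)
    case (single i c)
    have "exponents (replicate_mset c (Suc i)) = Poly_Mapping.single i c"
      by (induction c) (simp_all add: exponents_def flip: single_add)
    then show ?case
      by (intro exI[of _ "replicate_mset c (Suc i)"]) simp
  next
    case (add u v)
    then obtain p q where "0 \<notin># p" "exponents p = u" "0 \<notin># q" "exponents q = v"
      by blast
    then show ?case
      by (intro exI[of _ "p + q"]) (simp add: exponents_def)
  qed
  then show ?thesis
    using that by blast
qed

definition monom_vec :: "int \<times> nat multiset \<Rightarrow> V" where
  "monom_vec = (\<lambda>(k, p). tensor (\<Prod>i\<in>#p. hvar i) k)"

lemma monom_vec_eq: "monom_vec (k, p) = Poly_Mapping.single k (Poly_Mapping.single (exponents p) 1)"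
  by (simp add: monom_vec_def tensor_def prod_hvar)

lemma lookup_monom_vec:
  "Poly_Mapping.lookup (Poly_Mapping.lookup (monom_vec (k, p)) l) u =
     (if k = l \<and> exponents p = u then 1 else 0)"
  by (simp add: monom_vec_eq lookup_single when_def)

lemma monom_vec_eq_iff: "monom_vec (k, p) = monom_vec (l, q) \<longleftrightarrow> k = l \<and> exponents p = exponents q"
proof
  assume "monom_vec (k, p) = monom_vec (l, q)"
  then show "k = l \<and> exponents p = exponents q"
    using lookup_monom_vec[of k p k "exponents p"] lookup_monom_vec[of l q k "exponents p"]
    by (auto split: if_splits)
qed (simp add: monom_vec_eq)

lemma inj_on_monom_vec: "inj_on monom_vec (UNIV \<times> {p. 0 \<notin># p})"
  using inj_on_exponents by (auto simp: inj_on_def monom_vec_eq_iff)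

lemma lookup_scaleV:
  "Poly_Mapping.lookup (Poly_Mapping.lookup (scaleV c v) k) u =
     c * Poly_Mapping.lookup (Poly_Mapping.lookup v k) u"
proof -
  have "Poly_Mapping.lookup (scaleV c v) k = scale0 c (Poly_Mapping.lookup v k)"
    unfolding scaleV_def scale0_def mult_map_scale_conv_mult[of "Poly_Mapping.single 0 c" v, symmetric]
    by (simp add: Poly_Mapping.map.rep_eq when_def)
  then show ?thesis
    by (simp add: lookup_scale0)
qed

text \<open>A monomial has coefficient 1 at its own exponent vector and charge, where every other
  monomial has coefficient 0. Reading off that coefficient isolates one scalar of a
  relation.\<close>

lemma independent_monom_vec: "VC.independent (range monom_vec)"
  unfolding VC.independent_explicit_finite_subsets
proof (intro allI impI ballI)
  fix S and c :: "V \<Rightarrow> complex" and v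
  assume S: "S \<subseteq> range monom_vec" "finite S" and 0: "(\<Sum>w\<in>S. scaleV (c w) w) = 0" and v: "v \<in> S"
  obtain k p where kp: "v = monom_vec (k, p)"
    using S(1) v by auto
  let ?coeff = "\<lambda>w :: V. Poly_Mapping.lookup (Poly_Mapping.lookup w k) (exponents p)"
  have "?coeff w = (if w = v then 1 else 0)" if w: "w \<in> S" for w
  proof -
    obtain l q where "w = monom_vec (l, q)"
      using S(1) w by auto
    then show ?thesis
      using kp by (auto simp: monom_vec_eq_iff lookup_monom_vec)
  qed
  then have "(\<Sum>w\<in>S. c w * ?coeff w) = (\<Sum>w\<in>S. if w = v then c w else 0)"
    by (intro sum.cong) auto
  also have "\<dots> = c v"
    using S(2) v by simp
  finally have "c v = ?coeff (\<Sum>w\<in>S. scaleV (c w) w)"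
    by (simp add: lookup_sum lookup_scaleV)
  then show "c v = 0"
    unfolding 0 by simp
qed

section \<open>Passing between rational and complex scalars\<close>

lemma subspace_VF_of_VC: "VC.subspace W \<Longrightarrow> VF.subspace W"
  by (simp add: VC.subspace_def VF.subspace_def scaleF_def)

lemma VF_span_le_VC_span: "VF.span B \<subseteq> VC.span B"
  by (intro VF.span_minimal VC.span_superset subspace_VF_of_VC VC.subspace_span)

text \<open>A rational relation is a complex one. Hence independence is proved over the complex
  numbers and spanning by the products over the rationals, and both are then transferred to the
  other field.\<close>

lemma VF_independent_of_VC:
  assumes "VC.independent B"
  shows "VF.independent B"
  unfolding VF.independent_explicit_finite_subsets
proof (intro allI impI ballI)
  fix S and c :: "V \<Rightarrow> rat" and v
  assume S: "S \<subseteq> B" "finite S" "(\<Sum>v\<in>S. scaleF (c v) v) = 0" "v \<in> S"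
  then have "of_rat (c v) = (0 :: complex)"
    using VC.independentD[OF assms S(2,1), of "\<lambda>v. of_rat (c v)" v] by (simp add: scaleF_def)
  then show "c v = 0"
    by simp
qed

lemma V_charges_subspace: "VC.subspace (V_charges K)"
proof (rule VC.subspaceI)
  fix c v w assume "v \<in> V_charges K" "w \<in> V_charges K"
  then show "v + w \<in> V_charges K"
    using keys_add[of v w] by (auto simp: V_charges_def)
next
  fix c v assume "v \<in> V_charges K"
  then show "scaleV c v \<in> V_charges K"
    using keys_mult[of "Poly_Mapping.single 0 (Poly_Mapping.single 0 c)" v]
    by (auto simp: V_charges_def scaleV_def split: if_splits)
qed (simp add: V_charges_def)

lemma V_rational_subspace: "VF.subspace (V_rational K)"
proof -
  note V = V_charges_subspace[THEN subspace_VF_of_VC]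
  show ?thesis
    by (rule VF.subspaceI)
      (use VF.subspace_0[OF V] VF.subspace_add[OF V] VF.subspace_scale[OF V] in
        \<open>auto simp: V_rational_def lookup_add scaleF_def lookup_scaleV\<close>)
qed

text \<open>The monomial expansion of v, with a chosen multiset \<open>q u\<close> for each exponent
  vector u. Complex and rational spanning are both read off from it.\<close>

lemma monom_vec_sum:
  obtains q where "\<And>u. 0 \<notin># q u"
    "\<And>v. (\<Sum>k\<in>Poly_Mapping.keys v. \<Sum>u\<in>Poly_Mapping.keys (Poly_Mapping.lookup v k).
       scaleV (Poly_Mapping.lookup (Poly_Mapping.lookup v k) u) (monom_vec (k, q u))) = v"
proof -
  have "\<forall>u. \<exists>p. 0 \<notin># p \<and> exponents p = u"
    by (metis exponents_surj)
  then obtain q where q: "\<And>u. 0 \<notin># q u" "\<And>u. exponents (q u) = u"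
    by metis
  have "(\<Sum>k\<in>Poly_Mapping.keys v. \<Sum>u\<in>Poly_Mapping.keys (Poly_Mapping.lookup v k).
       scaleV (Poly_Mapping.lookup (Poly_Mapping.lookup v k) u) (monom_vec (k, q u))) = v" for v
  proof -
    have "scaleV c (monom_vec (k, q u)) = tensor (Poly_Mapping.single u c) k" for c k u
      by (simp add: monom_vec_eq q scaleV_def tensor_def mult_single)
    then have "(\<Sum>k\<in>Poly_Mapping.keys v. \<Sum>u\<in>Poly_Mapping.keys (Poly_Mapping.lookup v k).
        scaleV (Poly_Mapping.lookup (Poly_Mapping.lookup v k) u) (monom_vec (k, q u))) =
        (\<Sum>k\<in>Poly_Mapping.keys v. tensor (Poly_Mapping.lookup v k) k)"
      by (simp add: poly_mapping_sum_single flip: tensor_sum)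
    then show ?thesis
      by (simp add: tensor_def poly_mapping_sum_single)
  qed
  with q(1) show ?thesis
    by (rule that)
qed

lemma V_charges_subset_span: "V_charges K \<subseteq> VC.span (monom_vec ` (K \<times> {p. 0 \<notin># p}))"
proof
  obtain q where q: "\<And>u. 0 \<notin># q u"
    "\<And>v. (\<Sum>k\<in>Poly_Mapping.keys v. \<Sum>u\<in>Poly_Mapping.keys (Poly_Mapping.lookup v k).
       scaleV (Poly_Mapping.lookup (Poly_Mapping.lookup v k) u) (monom_vec (k, q u))) = v"
    using that by (rule monom_vec_sum)
  fix v assume "v \<in> V_charges K"
  then show "v \<in> VC.span (monom_vec ` (K \<times> {p. 0 \<notin># p}))"
    by (subst q(2)[symmetric], intro VC.span_sum VC.span_scale VC.span_base imageI)
      (auto simp: V_charges_def q(1))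
qed

lemma V_rational_subset_span: "V_rational K \<subseteq> VF.span (monom_vec ` (K \<times> {p. 0 \<notin># p}))"
proof
  obtain q where q: "\<And>u. 0 \<notin># q u"
    "\<And>v. (\<Sum>k\<in>Poly_Mapping.keys v. \<Sum>u\<in>Poly_Mapping.keys (Poly_Mapping.lookup v k).
       scaleV (Poly_Mapping.lookup (Poly_Mapping.lookup v k) u) (monom_vec (k, q u))) = v"
    using that by (rule monom_vec_sum)
  fix v assume v: "v \<in> V_rational K"
  show "v \<in> VF.span (monom_vec ` (K \<times> {p. 0 \<notin># p}))"
  proof (subst q(2)[symmetric], intro VF.span_sum)
    fix k u assume k: "k \<in> Poly_Mapping.keys v"
    have "Poly_Mapping.lookup (Poly_Mapping.lookup v k) u \<in> \<rat>"
      using v by (simp add: V_rational_def)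
    then obtain r where r: "Poly_Mapping.lookup (Poly_Mapping.lookup v k) u = of_rat r"
      by (rule Rats_cases)
    have "(k, q u) \<in> K \<times> {p. 0 \<notin># p}"
      using v k q(1) by (auto simp: V_rational_def V_charges_def)
    then have "scaleF r (monom_vec (k, q u)) \<in> VF.span (monom_vec ` (K \<times> {p. 0 \<notin># p}))"
      by (intro VF.span_scale VF.span_base imageI)
    then show "scaleV (Poly_Mapping.lookup (Poly_Mapping.lookup v k) u) (monom_vec (k, q u))
        \<in> VF.span (monom_vec ` (K \<times> {p. 0 \<notin># p}))"
      by (simp add: scaleF_def r)
  qed
qed

text \<open>The rational span of the monomials is closed under products, and it contains every
  \<open>H\<close> because the defining coefficients are rational.\<close>

lemma H_list_rational: "Poly_Mapping.lookup (H_list \<alpha> s) u \<in> \<rat>"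
proof -
  let ?M = "range (\<lambda>u. Poly_Mapping.single u 1 :: V0)"
  have mult: "p * q \<in> V0Q.span ?M" if "p \<in> V0Q.span ?M" "q \<in> V0Q.span ?M" for p q
    using that by (rule V0Q_span_mult) (auto simp: mult_single intro!: V0Q.span_base)
  have one: "1 \<in> V0Q.span ?M"
    by (rule V0Q.span_base) (metis rangeI single_one)
  have "H \<alpha> n \<in> V0Q.span ?M" for n
  proof -
    have "scaleQ (of_nat \<alpha> ^ size \<nu> * inverse (of_nat (zee \<nu>))) (\<Prod>i\<in>#\<nu>. hvar i) \<in> V0Q.span ?M" for \<nu>
      by (intro V0Q.span_scale V0Q.span_base) (auto simp: prod_hvar)
    then have "(\<Sum>\<nu>\<in>partitions (nat n). scaleQ (of_nat \<alpha> ^ size \<nu> * inverse (of_nat (zee \<nu>)))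
        (\<Prod>i\<in>#\<nu>. hvar i)) \<in> V0Q.span ?M"
      by (intro V0Q.span_sum)
    then show ?thesis
      by (simp add: H_def scaleQ_def of_rat_mult of_rat_inverse of_rat_power V0Q.span_zero)
  qed
  then have "H_list \<alpha> s \<in> V0Q.span ?M"
    by (induction s) (simp_all add: mult one)
  moreover have "V0Q.subspace {p. \<forall>u. Poly_Mapping.lookup p u \<in> \<rat>}"
    by (rule V0Q.subspaceI) (auto simp: lookup_add scaleQ_def lookup_scale0)
  then have "V0Q.span ?M \<subseteq> {p. \<forall>u. Poly_Mapping.lookup p u \<in> \<rat>}"
    by (rule V0Q.span_minimal[rotated]) (auto simp: lookup_single when_def)
  ultimately show ?thesis
    by blast
qed

lemma X_part_in_V_rational:
  assumes "\<alpha> > 0" "k \<in> K"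
  shows "X_part \<alpha> k p \<in> V_rational K"
proof -
  have tensor: "tensor (H_list \<alpha> s) k \<in> V_rational K" for s
    using assms(2) H_list_rational
    by (auto simp: V_rational_def V_charges_def tensor_def lookup_single when_def split: if_splits)
  define k' where "k' = k - 2 * int (size p)"
  define \<nu> where "\<nu> = unshift \<alpha> k' (part_list p)"
  obtain S and a :: "int list \<Rightarrow> rat" where
    "\<forall>k. X_neg \<alpha> \<nu> (exph k) =
      tensor (\<Sum>\<mu>\<in>S. scale0 (of_rat (a \<mu>)) (H_list \<alpha> (shift \<alpha> k \<mu>))) (k + 2 * int (length \<nu>))"
    using X_neg_expansion[OF assms(1), of \<nu>] by (elim exE conjE)
  then have "X_part \<alpha> k p = (\<Sum>\<mu>\<in>S. scaleF (a \<mu>) (tensor (H_list \<alpha> (shift \<alpha> k' \<mu>)) k))"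
    unfolding X_part_def k'_def[symmetric] \<nu>_def[symmetric]
    by (simp add: tensor_sum tensor_scale0_of_rat) (simp add: \<nu>_def k'_def)
  also have "\<dots> \<in> V_rational K"
    by (intro VF.subspace_sum VF.subspace_scale V_rational_subspace tensor)
  finally show ?thesis .
qed

lemma monom_vec_in_span:
  assumes "\<alpha> > 0" "0 \<notin># p"
  shows "monom_vec (k, p) \<in> VF.span (X_part \<alpha> k ` partitions (sum_mset p))"
  using tensor_prod_hvar_in_span[OF assms(1), of p "sum_mset p" k] assms(2)
  by (simp add: monom_vec_def partitions_def)

text \<open>The products in a finite truncation span as many independent monomials as there are indices, so
  they are distinct and independent.\<close>

lemma independent_X_part:
  assumes "\<alpha> > 0"
  shows "VC.independent ((\<lambda>(k, p). X_part \<alpha> k p) ` (UNIV \<times> {p. 0 \<notin># p}))"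
proof -
  let ?X = "\<lambda>(k, p). X_part \<alpha> k p"
  \<comment> \<open>Bounding charge and degree makes \<open>I N\<close> finite. Each block of fixed
    charge and degree is taken whole, so the monomials indexed by \<open>I N\<close> lie in the span
    of the products indexed by it.\<close>
  define I where "I N = {- int N..int N} \<times> (\<Union>n\<le>N. partitions n)" for N
  have finite_I: "finite (I N)" for N
    by (simp add: I_def finite_partitions)
  have indep_I: "VC.independent (?X ` I N)" for N
  proof
    have I: "I N \<subseteq> UNIV \<times> {p. 0 \<notin># p}"
      by (auto simp: I_def partitions_def)
    have "monom_vec (k, p) \<in> VC.span (?X ` I N)" if "(k, p) \<in> I N" for k p
    proof -
      have "X_part \<alpha> k ` partitions (sum_mset p) \<subseteq> ?X ` I N"
        using that by (force simp: I_def partitions_def)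
      moreover have "monom_vec (k, p) \<in> VF.span (X_part \<alpha> k ` partitions (sum_mset p))"
        using that I by (intro monom_vec_in_span[OF assms]) auto
      ultimately show ?thesis
        using VF.span_mono VF_span_le_VC_span by blast
    qed
    then have sub: "monom_vec ` I N \<subseteq> VC.span (?X ` I N)"
      by auto
    assume "VC.dependent (?X ` I N)"
    \<comment> \<open>Removing a redundant vector would leave fewer than \<open>card (I N)\<close>
      vectors whose span contains \<open>card (I N)\<close> independent monomials.\<close>
    then obtain x where x: "x \<in> ?X ` I N" "x \<in> VC.span (?X ` I N - {x})"
      unfolding VC.dependent_def by blast
    then have "VC.span (?X ` I N) = VC.span (?X ` I N - {x})"
      using VC.span_redundant[OF x(2)] by (simp add: insert_absorb)
    with sub have "card (monom_vec ` I N) \<le> card (?X ` I N - {x})"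
      using VC.independent_span_bound[of "?X ` I N - {x}" "monom_vec ` I N"] finite_I
        VC.independent_mono[OF independent_monom_vec, of "monom_vec ` I N"] by auto
    also have "\<dots> < card (?X ` I N)"
      using x(1) finite_I by (intro psubset_card_mono) auto
    also have "\<dots> \<le> card (I N)"
      using finite_I by (rule card_image_le)
    also have "card (I N) = card (monom_vec ` I N)"
      using inj_on_subset[OF inj_on_monom_vec I] by (simp add: card_image)
    finally show False
      by simp
  qed
  \<comment> \<open>The truncations form a chain, so their union inherits independence.\<close>
  have "I M \<subseteq> I N" if "M \<le> N" for M N
    using that unfolding I_def by (intro Sigma_mono UN_mono) auto
  then have "?X ` I M \<subseteq> ?X ` I N \<or> ?X ` I N \<subseteq> ?X ` I M" for M N
    by (metis image_mono linear)
  then have "VC.independent (\<Union>(range (\<lambda>N. ?X ` I N)))"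
    by (intro VC.independent_Union_directed) (use indep_I in blast)+
  moreover have "UNIV \<times> {p. 0 \<notin># p} \<subseteq> (\<Union>N. I N)"
  proof clarify
    fix k :: int and p :: "nat multiset"
    assume "0 \<notin># p"
    define n where "n = sum_mset p"
    have "p \<in> partitions n"
      using \<open>0 \<notin># p\<close> by (simp add: partitions_def n_def)
    then have "(k, p) \<in> I (nat \<bar>k\<bar> + n)"
      by (auto simp: I_def)
    then show "(k, p) \<in> (\<Union>N. I N)"
      by blast
  qed
  then have "?X ` (UNIV \<times> {p. 0 \<notin># p}) \<subseteq> \<Union>(range (\<lambda>N. ?X ` I N))"
    by (simp only: image_UN[symmetric]) (rule image_mono)
  ultimately show ?thesis
    by (rule VC.independent_mono)
qed

section \<open>The bases and the expansion\<close>

lemma products_basis: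
  assumes "\<alpha> > 0" and K: "\<And>k. k + 2 \<in> K \<longleftrightarrow> k \<in> K"
  shows "is_F_basis (products \<alpha> K) (V_rational K)" "is_C_basis (products \<alpha> K) (V_charges K)"
proof -
  note eq = products_eq[OF assms(1), of K, OF K]
  have indep: "VC.independent (products \<alpha> K)"
    unfolding eq by (rule VC.independent_mono[OF independent_X_part[OF assms(1)]]) auto
  have sub: "products \<alpha> K \<subseteq> V_rational K"
    using X_part_in_V_rational[OF assms(1)] by (auto simp: eq)
  have "monom_vec (k, p) \<in> VF.span (products \<alpha> K)" if "k \<in> K" "0 \<notin># p" for k p
  proof -
    have "X_part \<alpha> k ` partitions (sum_mset p) \<subseteq> products \<alpha> K"
      using that(1) by (force simp: eq partitions_def)
    then show ?thesis
      using monom_vec_in_span[OF assms(1) that(2), of k] VF.span_mono by blast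
  qed
  then have monom: "monom_vec ` (K \<times> {p. 0 \<notin># p}) \<subseteq> VF.span (products \<alpha> K)"
    by auto
  have "VF.span (products \<alpha> K) = V_rational K"
    using VF.span_minimal[OF sub V_rational_subspace] V_rational_subset_span
      VF.span_minimal[OF monom VF.subspace_span] by blast
  then show "is_F_basis (products \<alpha> K) (V_rational K)"
    using VF_independent_of_VC[OF indep] by (simp add: is_F_basis_def)
  have "products \<alpha> K \<subseteq> V_charges K"
    using sub by (auto simp: V_rational_def)
  then have "VC.span (products \<alpha> K) \<subseteq> V_charges K"
    by (rule VC.span_minimal[OF _ V_charges_subspace])
  moreover have "monom_vec ` (K \<times> {p. 0 \<notin># p}) \<subseteq> VC.span (products \<alpha> K)"
    using monom VF_span_le_VC_span by blast
  then have "V_charges K \<subseteq> VC.span (products \<alpha> K)"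
    using V_charges_subset_span VC.span_minimal[OF _ VC.subspace_span] by blast
  ultimately show "is_C_basis (products \<alpha> K) (V_charges K)"
    unfolding is_C_basis_def using indep by blast
qed

lemma X_neg_H_list_expansion:
  assumes "\<alpha> > 0"
  shows "\<exists>a :: int list \<Rightarrow> rat. a \<nu> = 1 \<and> finite {\<mu>. a \<mu> \<noteq> 0} \<and>
    (\<forall>m. X_neg \<alpha> \<nu> (exph (2 * m)) = (\<Sum>\<mu> \<in> {\<mu>. dominates \<mu> \<nu> \<and> a \<mu> \<noteq> 0}.
      scaleF (a \<mu>) (tensor (H_list \<alpha> (shifted \<alpha> m \<mu>)) (2 * (m + int (length \<nu>))))))"
proof -
  obtain S and a :: "int list \<Rightarrow> rat" where
    S: "finite S" "\<forall>\<mu>\<in>S. dominates \<mu> \<nu>" "\<nu> \<in> S" "a \<nu> = 1" and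
    X: "\<forall>k. X_neg \<alpha> \<nu> (exph k) =
      tensor (\<Sum>\<mu>\<in>S. scale0 (of_rat (a \<mu>)) (H_list \<alpha> (shift \<alpha> k \<mu>))) (k + 2 * int (length \<nu>))"
    using X_neg_expansion[OF assms, of \<nu>] by (elim exE conjE)
  \<comment> \<open>Coefficients 0 outside \<open>S\<close> give a finite support, so the sum can be
    taken over all dominating lists with nonzero coefficient.\<close>
  define b where "b \<mu> = (if \<mu> \<in> S then a \<mu> else 0)" for \<mu>
  show ?thesis
  proof (intro exI[of _ b] conjI allI)
    show "b \<nu> = 1"
      using S by (simp add: b_def)
    have sub: "{\<mu>. b \<mu> \<noteq> 0} \<subseteq> S"
      by (auto simp: b_def)
    then show "finite {\<mu>. b \<mu> \<noteq> 0}"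
      using S(1) finite_subset by blast
    fix m
    let ?T = "\<lambda>\<mu>. tensor (H_list \<alpha> (shifted \<alpha> m \<mu>)) (2 * (m + int (length \<nu>)))"
    have "X_neg \<alpha> \<nu> (exph (2 * m)) = (\<Sum>\<mu>\<in>S. scaleF (a \<mu>) (?T \<mu>))"
      using X by (simp add: tensor_sum tensor_scale0_of_rat shifted_eq_shift algebra_simps)
    also have "\<dots> = (\<Sum>\<mu>\<in>S. scaleF (b \<mu>) (?T \<mu>))"
      by (intro sum.cong) (auto simp: b_def)
    also have "\<dots> = (\<Sum>\<mu>\<in>{\<mu>. dominates \<mu> \<nu> \<and> b \<mu> \<noteq> 0}. scaleF (b \<mu>) (?T \<mu>))"
      using S sub by (intro sum.mono_neutral_right) auto
    finally show "X_neg \<alpha> \<nu> (exph (2 * m)) =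
        (\<Sum>\<mu>\<in>{\<mu>. dominates \<mu> \<nu> \<and> b \<mu> \<noteq> 0}. scaleF (b \<mu>) (?T \<mu>))" .
  qed
qed

theorem theorem3p6:
  fixes \<alpha> :: nat
  assumes "\<alpha> > 0"
  shows "(\<forall>K \<in> {{2 * m | m. True}, UNIV}.
            is_F_basis (products \<alpha> K) (V_rational K) \<and>
            is_C_basis (products \<alpha> K) (V_charges K)) \<and>
         (\<exists>a :: int list \<Rightarrow> int list \<Rightarrow> rat.
            \<forall>(m :: int) (\<nu> :: int list).
              sorted_wrt (\<ge>) \<nu> \<and> (\<nu> \<noteq> [] \<longrightarrow> last \<nu> \<ge> (2 * m + 1) * int \<alpha>) \<longrightarrow>
              a \<nu> \<nu> = 1 \<and>
              finite {\<mu>. a \<nu> \<mu> \<noteq> 0} \<and>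
              X_neg \<alpha> \<nu> (exph (2 * m)) =
                (\<Sum>\<mu> \<in> {\<mu>. dominates \<mu> \<nu> \<and> a \<nu> \<mu> \<noteq> 0}.
                   scaleF (a \<nu> \<mu>)
                     (tensor (H_list \<alpha> (shifted \<alpha> m \<mu>)) (2 * (m + int (length \<nu>))))))"
proof
  have "k + 2 \<in> {2 * m | m. True} \<longleftrightarrow> k \<in> {2 * m | m. True}" for k :: int
    by (auto, presburger, presburger)
  then show "\<forall>K \<in> {{2 * m | m. True}, UNIV}. is_F_basis (products \<alpha> K) (V_rational K) \<and>
      is_C_basis (products \<alpha> K) (V_charges K)"
    using products_basis[OF assms] by blast
  \<comment> \<open>The coefficients are chosen for each \<nu> before m is fixed, so that one family
    \<open>a\<close> serves all charges.\<close>
  have "\<forall>\<nu>. \<exists>a :: int list \<Rightarrow> rat. a \<nu> = 1 \<and> finite {\<mu>. a \<mu> \<noteq> 0} \<and>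
    (\<forall>m. X_neg \<alpha> \<nu> (exph (2 * m)) = (\<Sum>\<mu> \<in> {\<mu>. dominates \<mu> \<nu> \<and> a \<mu> \<noteq> 0}.
      scaleF (a \<mu>) (tensor (H_list \<alpha> (shifted \<alpha> m \<mu>)) (2 * (m + int (length \<nu>))))))"
    by (intro allI X_neg_H_list_expansion[OF assms])
  from choice[OF this]
  obtain a :: "int list \<Rightarrow> int list \<Rightarrow> rat" where a: "\<forall>\<nu>. a \<nu> \<nu> = 1 \<and> finite {\<mu>. a \<nu> \<mu> \<noteq> 0} \<and>
    (\<forall>m. X_neg \<alpha> \<nu> (exph (2 * m)) = (\<Sum>\<mu> \<in> {\<mu>. dominates \<mu> \<nu> \<and> a \<nu> \<mu> \<noteq> 0}.
      scaleF (a \<nu> \<mu>) (tensor (H_list \<alpha> (shifted \<alpha> m \<mu>)) (2 * (m + int (length \<nu>))))))"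
    by (elim exE)
  show "\<exists>a :: int list \<Rightarrow> int list \<Rightarrow> rat. \<forall>(m :: int) (\<nu> :: int list).
      sorted_wrt (\<ge>) \<nu> \<and> (\<nu> \<noteq> [] \<longrightarrow> last \<nu> \<ge> (2 * m + 1) * int \<alpha>) \<longrightarrow>
      a \<nu> \<nu> = 1 \<and> finite {\<mu>. a \<nu> \<mu> \<noteq> 0} \<and>
      X_neg \<alpha> \<nu> (exph (2 * m)) = (\<Sum>\<mu> \<in> {\<mu>. dominates \<mu> \<nu> \<and> a \<nu> \<mu> \<noteq> 0}.
        scaleF (a \<nu> \<mu>) (tensor (H_list \<alpha> (shifted \<alpha> m \<mu>)) (2 * (m + int (length \<nu>)))))"
    using a by (intro exI[of _ a] allI impI) (elim allE conjE, intro conjI)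
qed

end
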